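(* There exists an absolute constant $c>0$ and an infinite family of $k$-unicast instances whose makespan coding gap is at least $\Omega(\log^{c} k)$.
   Context: A $k$-unicast instance $\mathcal{M}=(G,\mathcal{S})$ consists of a connected undirected graph $G=(V,E)$ with an integer capacity $c_e\ge 1$ on each edge and $k$ sessions $\mathcal{S}=\{(s_i,t_i,d_i)\}_{i=1}^k$, where $s_i\in V$ is a source, $t_i\in V$ its sink, and $d_i\in\mathbb{Z}_{\ge1}$ is the number of (equal-size) sub-packets of the packet $s_i$ must deliver to $t_i$. A protocol runs in synchronous rounds; initially $s_i$ knows its packet. In each round every node $v$ sends along each incident edge $e$ a message of at most $c_e$ sub-packets, computed by a predetermined function of the packets $v$ received in earlier rounds and those originating at $v$. Network coding protocols may use arbitrary such functions; routing protocols may only forward sub-packets that $v$ has received so far or that originate at $v$. A protocol has completion times $(T_1,\dots,T_k)$ if for each $i$, after $T_i$ rounds $t_i$ can determine the packet of $s_i$; its makespan is $\max_i T_i$. The makespan coding gap of $\mathcal{M}$ is the ratio of the smallest makespan of any routing protocol for $\mathcal{M}$ to the smallest makespan of any network coding protocol for $\mathcal{M}$. *)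

theory Defs
  imports
    "HOL-Library.Landau_Symbols"
    "Graph_Theory.Digraph_Component"
begin

section \<open>Multiple-unicast instances\<close>

record 'v session =
  source :: 'v
  sink :: 'v
  demand :: nat

record 'v unicast =
  network :: "'v pair_pre_digraph"
  capacity :: "'v set \<Rightarrow> nat"
  sessions :: "'v session list"

abbreviation links :: "'v unicast \<Rightarrow> ('v \<times> 'v) set" where
  "links M \<equiv> parcs (network M)"

definition num_sessions :: "'v unicast \<Rightarrow> nat" where
  "num_sessions M = length (sessions M)"

abbreviation src :: "'v unicast \<Rightarrow> nat \<Rightarrow> 'v" where
  "src M i \<equiv> source (sessions M ! i)"

abbreviation snk :: "'v unicast \<Rightarrow> nat \<Rightarrow> 'v" where
  "snk M i \<equiv> sink (sessions M ! i)"

abbreviation dem :: "'v unicast \<Rightarrow> nat \<Rightarrow> nat" where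
  "dem M i \<equiv> demand (sessions M ! i)"

text \<open>
  An undirected graph is a symmetric loop-free digraph: the edge \<open>{u, v}\<close> is the pair of
  arcs \<open>(u, v)\<close>, \<open>(v, u)\<close>. The capacity belongs to the undirected edge, and bounds the
  message sent in each of the two directions.
\<close>

definition unicast_instance :: "'v unicast \<Rightarrow> bool" where
  "unicast_instance M \<longleftrightarrow>
     pair_graph (network M) \<and>
     Digraph_Component.connected (with_proj (network M)) \<and>
     (\<forall>(u, v) \<in> links M. 1 \<le> capacity M {u, v}) \<and>
     1 \<le> num_sessions M \<and>
     (\<forall>i < num_sessions M.
        src M i \<in> pverts (network M) \<and> snk M i \<in> pverts (network M) \<and> 1 \<le> dem M i)"


section \<open>Protocols\<close>

text \<open>
  A sub-packet is an element of the alphabet \<open>{..<q}\<close>; the size \<open>q\<close> is part of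
  the protocol and is the same for the sub-packets of packets and of messages.
\<close>

type_synonym subpacket = nat

definition subpacket_strings :: "nat \<Rightarrow> nat \<Rightarrow> subpacket list set" where
  "subpacket_strings q l = {w. length w = l \<and> set w \<subseteq> {..<q}}"

text \<open>
  A history lists, round by round, the messages a node received, indexed by the neighbour that
  sent them. The number of the current round is the length of the history, so the message
  functions of a protocol may depend on the round.
\<close>

type_synonym 'v history = "('v \<Rightarrow> subpacket list) list"

record 'v protocol =
  alphabet_size :: nat
  message :: "'v \<Rightarrow> 'v \<Rightarrow> (nat \<rightharpoonup> subpacket list) \<Rightarrow> 'v history \<Rightarrow> subpacket list"
    \<comment> \<open>\<open>message P u v own hist\<close> is what \<open>u\<close> sends to \<open>v\<close>\<close>

text \<open>An input \<open>x\<close> assigns to every session \<open>i\<close> the packet \<open>x ! i\<close>.\<close>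

definition inputs :: "'v unicast \<Rightarrow> nat \<Rightarrow> subpacket list list set" where
  "inputs M q = {x. length x = num_sessions M \<and>
     (\<forall>i < num_sessions M. x ! i \<in> subpacket_strings q (dem M i))}"

definition own_packets ::
    "'v unicast \<Rightarrow> subpacket list list \<Rightarrow> 'v \<Rightarrow> (nat \<rightharpoonup> subpacket list)" where
  "own_packets M x u = (\<lambda>i. if i < num_sessions M \<and> src M i = u then Some (x ! i) else None)"

text \<open>
  \<open>transcript M P x r\<close> lists the messages sent in the first \<open>r\<close> rounds;
  its entries map sender and receiver to the message.
\<close>

definition received :: "('v \<Rightarrow> 'v \<Rightarrow> subpacket list) list \<Rightarrow> 'v \<Rightarrow> 'v history" where
  "received ms v = map (\<lambda>m u. m u v) ms"

primrec transcript ::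
    "'v unicast \<Rightarrow> 'v protocol \<Rightarrow> subpacket list list \<Rightarrow> nat \<Rightarrow> ('v \<Rightarrow> 'v \<Rightarrow> subpacket list) list" where
  "transcript M P x 0 = []"
| "transcript M P x (Suc r) = transcript M P x r @
     [\<lambda>u v. if (u, v) \<in> links M
            then message P u v (own_packets M x u) (received (transcript M P x r) u)
            else []]"

definition sent ::
    "'v unicast \<Rightarrow> 'v protocol \<Rightarrow> subpacket list list \<Rightarrow> nat \<Rightarrow> 'v \<Rightarrow> 'v \<Rightarrow> subpacket list" where
  "sent M P x r u v = (transcript M P x (Suc r) ! r) u v"

text \<open>
  The number of sub-packets sent over a link in a round may not depend on the input; otherwise
  the length of a message would carry information beyond the capacity.
\<close>

definition coding_protocol :: "'v unicast \<Rightarrow> 'v protocol \<Rightarrow> bool" where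
  "coding_protocol M P \<longleftrightarrow>
     2 \<le> alphabet_size P \<and>
     (\<forall>r. \<forall>(u, v) \<in> links M. \<exists>l \<le> capacity M {u, v}. \<forall>x \<in> inputs M (alphabet_size P).
        sent M P x r u v \<in> subpacket_strings (alphabet_size P) l)"

text \<open>
  A routing protocol treats sub-packets as indivisible tokens \<open>(i, j)\<close>, meaning
  sub-packet \<open>j\<close> of the packet of session \<open>i\<close>. Which tokens make up a message
  is fixed in advance by \<open>slot\<close>: if the choice of the tokens to forward depended on
  their values, it could itself be used for coding.
\<close>

definition available ::
    "'v unicast \<Rightarrow> (nat \<Rightarrow> 'v \<Rightarrow> 'v \<Rightarrow> (nat \<times> nat) list) \<Rightarrow> nat \<Rightarrow> 'v \<Rightarrow> (nat \<times> nat) set" where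
  "available M slot r u =
     {(i, j). i < num_sessions M \<and> j < dem M i \<and> src M i = u} \<union>
     {tok. \<exists>r' < r. \<exists>w. (w, u) \<in> links M \<and> tok \<in> set (slot r' w u)}"

definition routing_protocol :: "'v unicast \<Rightarrow> 'v protocol \<Rightarrow> bool" where
  "routing_protocol M P \<longleftrightarrow>
     coding_protocol M P \<and>
     (\<exists>slot. \<forall>r. \<forall>(u, v) \<in> links M.
        set (slot r u v) \<subseteq> available M slot r u \<and>
        (\<forall>x \<in> inputs M (alphabet_size P).
           sent M P x r u v = map (\<lambda>(i, j). x ! i ! j) (slot r u v)))"


section \<open>Completion times, makespan and coding gap\<close>

definition determines_packet :: "'v unicast \<Rightarrow> 'v protocol \<Rightarrow> nat \<Rightarrow> nat \<Rightarrow> bool" where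
  "determines_packet M P i T \<longleftrightarrow>
     (\<exists>decode. \<forall>x \<in> inputs M (alphabet_size P).
        decode (own_packets M x (snk M i)) (received (transcript M P x T) (snk M i)) = x ! i)"

definition has_completion_times :: "'v unicast \<Rightarrow> 'v protocol \<Rightarrow> (nat \<Rightarrow> nat) \<Rightarrow> bool" where
  "has_completion_times M P T \<longleftrightarrow> (\<forall>i < num_sessions M. determines_packet M P i (T i))"

definition makespan :: "'v unicast \<Rightarrow> (nat \<Rightarrow> nat) \<Rightarrow> nat" where
  "makespan M T = Max (T ` {..<num_sessions M})"

definition coding_makespan :: "'v unicast \<Rightarrow> nat" where
  "coding_makespan M =
     Inf {makespan M T | P T. coding_protocol M P \<and> has_completion_times M P T}"

definition routing_makespan :: "'v unicast \<Rightarrow> nat" where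
  "routing_makespan M =
     Inf {makespan M T | P T. routing_protocol M P \<and> has_completion_times M P T}"

definition makespan_coding_gap :: "'v unicast \<Rightarrow> real" where
  "makespan_coding_gap M = real (routing_makespan M) / real (coding_makespan M)"

end

theory Submission
  imports Defs "HOL-Library.Countable"
begin

text \<open>
  The base gadget has sources \<open>s\<^sub>i\<close>, sinks \<open>t\<^sub>i\<close>, a single bottleneck arc reached from all
  sources and reaching all sinks, and for every \<open>j\<close> a relay that collects all \<open>s\<^sub>i\<close> with \<open>i \<noteq> j\<close>
  and feeds \<open>t\<^sub>j\<close>. If every vertex forwards the sum modulo 2 of what it receives, then \<open>t\<^sub>j\<close> obtains
  the bit of \<open>s\<^sub>j\<close> within 3 rounds, whereas walks from \<open>s\<^sub>j\<close> to \<open>t\<^sub>j\<close> off the bottleneck have length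
  at least 4, so that routing in fewer than 4 rounds has to push all tokens through one arc.

  The gap is amplified by a product: the arcs of many copies of one gadget are replaced by
  sessions of many copies of another gadget. The linear codes compose, so the coding time \<open>a\<close>
  becomes \<open>a (a + 2)\<close>. If the copies are joined along a bipartite graph of large girth (here
  from \<open>SL\<^sub>2\<close> over the integers modulo a large number), then a short walk cannot profit from changing
  between copies, and the length \<open>b\<close> becomes \<open>b (b + 2)\<close>. After \<open>n\<close> squarings \<open>a + 1 = 4\<^sup>x\<close> and
  \<open>b + 1 = 5\<^sup>x\<close> with \<open>x = 2\<^sup>n\<close>, while the logarithm of the number of sessions is only
  exponential in \<open>x\<close>: the girth needed is polynomial in \<open>b\<close>, and the logarithm of the size of
  the group is linear in the girth.
\<close>

subsection \<open>Permutation systems of large girth\<close>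

text \<open>Walks in the bipartite graph whose sides are two copies of \<open>X\<close> and in which
  an edge labelled \<open>l\<close> joins \<open>x\<close> on the left to \<open>g l x\<close> on
  the right. An odd number of labels ends on the right-hand side, hence
  \<open>False\<close>.\<close>

fun zigzag :: "('l \<Rightarrow> 'x \<Rightarrow> 'x) \<Rightarrow> 'x set \<Rightarrow> 'l list \<Rightarrow> 'x \<Rightarrow> 'x \<Rightarrow> bool" where
  "zigzag g X [] x z \<longleftrightarrow> x = z"
| "zigzag g X [l] x z \<longleftrightarrow> False"
| "zigzag g X (l # l' # ls) x z \<longleftrightarrow> (\<exists>y\<in>X. g l x = g l' y \<and> zigzag g X ls y z)"

text \<open>
  The matrix \<open>U\<^sup>2\<^sup>i V\<^sup>2\<^sup>s U\<^sup>-\<^sup>2\<^sup>i\<close>, where \<open>U = (1 1; 0 1)\<close> and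
  \<open>V = (1 0; 1 1)\<close>, acting on column vectors. For \<open>s = 1\<close> these matrices generate a free
  group; reducing the entries modulo a large number keeps short words nontrivial.
\<close>

definition shear :: "int \<Rightarrow> int \<Rightarrow> int \<times> int \<Rightarrow> int \<times> int" where
  "shear s i v = (let p = fst v - 2 * i * snd v; q = snd v + 2 * s * p in (p + 2 * i * q, q))"

fun shears :: "(int \<times> int) list \<Rightarrow> int \<times> int \<Rightarrow> int \<times> int" where
  "shears [] v = v"
| "shears ((s, i) # w) v = shears w (shear s i v)"

definition vmod :: "int \<Rightarrow> int \<times> int \<Rightarrow> int \<times> int" where
  "vmod q v = (fst v mod q, snd v mod q)"

definition lincomb :: "int \<Rightarrow> int \<times> int \<Rightarrow> int \<Rightarrow> int \<times> int \<Rightarrow> int \<times> int" where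
  "lincomb a u b v = (a * fst u + b * fst v, a * snd u + b * snd v)"

lemma shears_lincomb: "shears w (lincomb a u b v) = lincomb a (shears w u) b (shears w v)"
proof (induction w arbitrary: u v)
  case (Cons x w)
  obtain s i where x: "x = (s, i)" by force
  have "shear s i (lincomb a u b v) = lincomb a (shear s i u) b (shear s i v)"
    by (simp add: shear_def lincomb_def Let_def algebra_simps)
  with Cons show ?case by (simp add: x)
qed simp

lemma shear_inverse: "shear (- s) i (shear s i v) = v"
  by (simp add: shear_def Let_def algebra_simps)

lemma vmod_eq_iff: "vmod q u = vmod q v \<longleftrightarrow> q dvd fst u - fst v \<and> q dvd snd u - snd v"
  by (simp add: vmod_def mod_eq_dvd_iff)

lemma vmod_lincomb: "vmod q u = vmod q u' \<Longrightarrow> vmod q v = vmod q v' \<Longrightarrow>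
   vmod q (lincomb a u b v) = vmod q (lincomb a u' b v')"
  unfolding vmod_def lincomb_def prod.inject by (auto intro!: mod_add_cong mod_mult_cong)

lemma vmod_shear: "vmod q u = vmod q v \<Longrightarrow> vmod q (shear s i u) = vmod q (shear s i v)"
  unfolding vmod_def shear_def Let_def
  by (auto intro!: mod_add_cong mod_diff_cong mod_mult_cong)

lemma vmod_shears: "vmod q u = vmod q v \<Longrightarrow> vmod q (shears w u) = vmod q (shears w v)"
proof (induction w arbitrary: u v)
  case (Cons x w)
  obtain s i where x: "x = (s, i)" by force
  show ?case using Cons.IH[OF vmod_shear[OF Cons.prems]] by (simp add: x)
qed simp

lemma vmod_vmod [simp]: "vmod q (vmod q v) = vmod q v"
  by (simp add: vmod_def)

definition det2 :: "(int \<times> int) \<times> (int \<times> int) \<Rightarrow> int" where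
  "det2 M = fst (fst M) * snd (snd M) - snd (fst M) * fst (snd M)"

lemma det2_shear: "det2 (shear s i u, shear s i v) = det2 (u, v)"
  by (simp add: det2_def shear_def Let_def algebra_simps)

lemma det2_vmod: "det2 (vmod q u, vmod q v) mod q = det2 (u, v) mod q"
  unfolding det2_def vmod_def fst_conv snd_conv by (intro mod_diff_cong mod_mult_cong) simp_all

section \<open>Ping-pong and the growth of entries\<close>

text \<open>The ping-pong set of the label \<open>i\<close>.\<close>

definition dominated :: "int \<Rightarrow> int \<times> int \<Rightarrow> bool" where
  "dominated i v \<longleftrightarrow> \<bar>fst v - 2 * i * snd v\<bar> < \<bar>snd v\<bar>"

text \<open>In the coordinates \<open>p = fst v - 2 * j * snd v\<close> and \<open>q = snd v\<close>
  the shear with label \<open>j\<close> only adds \<open>2 * s * p\<close> to \<open>q\<close>.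
  Domination for \<open>i\<close> together with \<open>i \<noteq> j\<close> forces
  \<open>\<bar>q\<bar> < \<bar>p\<bar>\<close>, so after adding plus or minus twice \<open>p\<close>
  the second coordinate is the larger one.\<close>

lemma dominated_shear:
  assumes "dominated i v" "i \<noteq> j" "s = 1 \<or> s = -1"
  shows "dominated j (shear s j v)"
proof -
  define a where "a = fst v - 2 * i * snd v"
  define p where "p = fst v - 2 * j * snd v"
  have p: "p = a + 2 * ((i - j) * snd v)"
    by (simp add: a_def p_def algebra_simps)
  have "\<bar>snd v\<bar> * 1 \<le> \<bar>snd v\<bar> * \<bar>i - j\<bar>"
    using assms(2) by (intro mult_left_mono) auto
  then have "\<bar>snd v\<bar> \<le> \<bar>(i - j) * snd v\<bar>"
    by (simp add: abs_mult mult.commute)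
  moreover have "\<bar>a\<bar> < \<bar>snd v\<bar>"
    using assms(1) by (simp add: dominated_def a_def)
  ultimately have "\<bar>snd v\<bar> < \<bar>p\<bar>"
    unfolding p by linarith
  then have "\<bar>p\<bar> < \<bar>snd v + 2 * s * p\<bar>"
    using assms(3) by auto
  then show ?thesis
    by (simp add: dominated_def shear_def Let_def p_def)
qed

lemma dominated_shears:
  assumes "dominated i v" "distinct_adj (i # map snd w)" "\<forall>s\<in>fst ` set w. s = 1 \<or> s = -1"
  shows "\<exists>j. dominated j (shears w v)"
  using assms
proof (induction w arbitrary: i v)
  case (Cons a w)
  obtain s j where a: "a = (s, j)" by force
  have "dominated j (shear s j v)"
    using Cons.prems by (intro dominated_shear[of i]) (auto simp: a)
  then show ?case
    using Cons.IH[of j "shear s j v"] Cons.prems by (auto simp: a)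
qed auto

lemma shear_bound:
  assumes "\<bar>fst v\<bar> \<le> c" "\<bar>snd v\<bar> \<le> c" "0 \<le> i" "i < d" "s = 1 \<or> s = -1"
  shows "\<bar>fst (shear s i v)\<bar> \<le> 8 * (d + 1)\<^sup>2 * c" "\<bar>snd (shear s i v)\<bar> \<le> 8 * (d + 1)\<^sup>2 * c"
proof -
  define p where "p = fst v - 2 * i * snd v"
  define q where "q = snd v + 2 * s * p"
  have c: "0 \<le> c" and d: "0 \<le> d" using assms by auto
  have aux: "\<bar>i * x\<bar> \<le> d * y" if "\<bar>x\<bar> \<le> y" for x y
    unfolding abs_mult using assms that by (intro mult_mono) auto
  have p: "\<bar>p\<bar> \<le> c + 2 * (d * c)"
    using aux[OF assms(2)] assms(1) unfolding p_def by simp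
  have q: "\<bar>q\<bar> \<le> 3 * c + 4 * (d * c)"
    using p assms(2,5) unfolding q_def by auto
  have e: "\<bar>p + 2 * i * q\<bar> \<le> c + 2 * (d * c) + 2 * (d * (3 * c + 4 * (d * c)))"
    using p aux[OF q] by simp
  have nn: "0 \<le> d * c" "0 \<le> d * (d * c)" using c d by auto
  have K: "8 * (d + 1)\<^sup>2 * c = 8 * (d * (d * c)) + 16 * (d * c) + 8 * c"
    by (simp add: power2_eq_square algebra_simps)
  have "c + 2 * (d * c) + 2 * (d * (3 * c + 4 * (d * c))) \<le> 8 * (d + 1)\<^sup>2 * c"
    unfolding K using nn c by (simp add: algebra_simps)
  with e show "\<bar>fst (shear s i v)\<bar> \<le> 8 * (d + 1)\<^sup>2 * c"
    by (simp add: shear_def Let_def p_def q_def)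
  have "3 * c + 4 * (d * c) \<le> 8 * (d + 1)\<^sup>2 * c"
    unfolding K using nn c by linarith
  with q show "\<bar>snd (shear s i v)\<bar> \<le> 8 * (d + 1)\<^sup>2 * c"
    by (simp add: shear_def Let_def p_def q_def)
qed

text \<open>The growth is exponential in the length of the word, with a base that depends only on
  the range of the labels; this determines how large the modulus has to be.\<close>

lemma shears_bound:
  assumes "\<bar>fst v\<bar> \<le> c" "\<bar>snd v\<bar> \<le> c"
    and "\<forall>(s, i)\<in>set w. 0 \<le> i \<and> i < d \<and> (s = 1 \<or> s = -1)"
  shows "\<bar>snd (shears w v)\<bar> \<le> (8 * (d + 1)\<^sup>2) ^ length w * c"
  using assms
proof (induction w arbitrary: v c)
  case (Cons a w)
  obtain s i where a: "a = (s, i)" by force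
  show ?case
    using Cons.IH[of "shear s i v" "8 * (d + 1)\<^sup>2 * c"] shear_bound[of v c i d s] Cons.prems
    by (simp add: a mult_ac)
qed auto

text \<open>A zigzag alternately follows an edge forwards, which is a shear, and backwards, which is
  the inverse of a shear; this is the matching word of shears.\<close>

fun signed :: "int list \<Rightarrow> (int \<times> int) list" where
  "signed [] = []"
| "signed [i] = [(1, i)]"
| "signed (i # j # is) = (1, i) # (-1, j) # signed is"

lemma signed_simps [simp]: "map snd (signed is) = is" "length (signed is) = length is"
  and signed_signs: "(s, i) \<in> set (signed is) \<Longrightarrow> i \<in> set is \<and> (s = 1 \<or> s = -1)"
  by (induction "is" rule: signed.induct) auto

text \<open>Ping-pong keeps the lower left entry of the integer matrix nonzero, and the growth bound
  keeps its absolute value below \<open>q\<close>, so it survives reduction modulo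
  \<open>q\<close>.\<close>

lemma shears_signed_nontrivial:
  assumes "is \<noteq> []" "distinct_adj is" "set is \<subseteq> {0..<d}" "length is \<le> L"
    and q: "(8 * (d + 1)\<^sup>2) ^ L < q"
  shows "\<not> q dvd snd (shears (signed is) (1, 0))"
proof
  assume dvd: "q dvd snd (shears (signed is) (1, 0))"
  obtain s i w where w: "signed is = (s, i) # w"
    using assms(1) by (cases "is" rule: signed.cases) auto
  have signs: "\<forall>(s, i)\<in>set (signed is). 0 \<le> i \<and> i < d \<and> (s = 1 \<or> s = -1)"
    using signed_signs[of _ _ "is"] assms(3) by fastforce
  have s: "s = 1 \<or> s = -1" "0 \<le> i" "i < d" using signs by (auto simp: w)
  have "distinct_adj (map snd (signed is))" using assms(2) by simp
  then have adj: "distinct_adj (i # map snd w)" unfolding w by simp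
  \<comment> \<open>\<open>(1, 0)\<close> itself lies in no ping-pong set, but after the first shear
    \<open>p\<close> is 1 and the second coordinate is 2 or -2.\<close>
  have "dominated i (shear s i (1, 0))"
    using s(1) by (auto simp: dominated_def shear_def)
  then obtain j where "dominated j (shears w (shear s i (1, 0)))"
    using dominated_shears[OF _ adj, of "shear s i (1, 0)"] signs unfolding w by fastforce
  then have nz: "snd (shears (signed is) (1, 0)) \<noteq> 0"
    by (auto simp: dominated_def w)
  have "\<bar>snd (shears (signed is) (1, 0))\<bar> \<le> (8 * (d + 1)\<^sup>2) ^ length is"
    using shears_bound[of "(1,0)" 1 "signed is" d] signs by simp
  also have "\<dots> \<le> (8 * (d + 1)\<^sup>2) ^ L"
  proof (rule power_increasing[OF assms(4)])
    have "0 < (d + 1)\<^sup>2" using s by simp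
    then show "1 \<le> 8 * (d + 1)\<^sup>2" by linarith
  qed
  finally have "\<bar>snd (shears (signed is) (1, 0))\<bar> < q" using q by simp
  with dvd_imp_le_int[OF nz dvd] show False by linarith
qed

section \<open>The action on SL2 modulo q\<close>

definition SL2 :: "int \<Rightarrow> ((int \<times> int) \<times> (int \<times> int)) set" where
  "SL2 q = {M \<in> ({0..<q} \<times> {0..<q}) \<times> ({0..<q} \<times> {0..<q}). det2 M mod q = 1}"

text \<open>A matrix is stored as its pair of columns, so this is left multiplication by the shear
  matrix, reduced modulo \<open>q\<close>.\<close>

definition act :: "int \<Rightarrow> int \<Rightarrow> int \<Rightarrow> (int \<times> int) \<times> (int \<times> int) \<Rightarrow> (int \<times> int) \<times> (int \<times> int)" where
  "act q s i M = (vmod q (shear s i (fst M)), vmod q (shear s i (snd M)))"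

lemma SL2_vmod: "M \<in> SL2 q \<Longrightarrow> vmod q (fst M) = fst M \<and> vmod q (snd M) = snd M"
  by (auto simp: SL2_def vmod_def)

lemma act_in_SL2: "1 < q \<Longrightarrow> M \<in> SL2 q \<Longrightarrow> act q s i M \<in> SL2 q"
proof -
  assume q: "1 < q" and M: "M \<in> SL2 q"
  have "det2 (act q s i M) mod q = det2 M mod q"
    unfolding act_def det2_vmod det2_shear by simp
  moreover have "vmod q v \<in> {0..<q} \<times> {0..<q}" for v
    using q by (simp add: vmod_def)
  ultimately show ?thesis
    using M unfolding SL2_def by (simp add: act_def)
qed

lemma act_inverse: "M \<in> SL2 q \<Longrightarrow> act q (- s) i (act q s i M) = M"
proof -
  assume M: "M \<in> SL2 q"
  have "vmod q (shear (- s) i (vmod q (shear s i v))) = vmod q v" for v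
    using vmod_shear[of q "vmod q (shear s i v)" "shear s i v" "- s" i]
    by (simp add: shear_inverse)
  then show ?thesis using SL2_vmod[OF M] by (simp add: act_def)
qed

text \<open>Each intermediate \<open>Y\<close> is found by inverting the second of two shears.
  Shears respect congruence modulo \<open>q\<close>, so a single reduction at the end
  suffices.\<close>

lemma zigzag_act:
  assumes "zigzag (\<lambda>l. act q 1 (f l)) (SL2 q) ls M Z" "M \<in> SL2 q" "1 < q"
  shows "Z = (vmod q (shears (signed (map f ls)) (fst M)), vmod q (shears (signed (map f ls)) (snd M)))"
  using assms
proof (induction ls arbitrary: M rule: induct_list012)
  case 1
  then show ?case using SL2_vmod by fastforce
next
  case (3 l l' ls)
  then obtain Y where Y: "Y \<in> SL2 q" "act q 1 (f l) M = act q 1 (f l') Y"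
    and z: "zigzag (\<lambda>l. act q 1 (f l)) (SL2 q) ls Y Z"
    by auto
  have "Y = act q (-1) (f l') (act q 1 (f l) M)"
    using act_inverse[OF Y(1), of 1] Y(2) by simp
  then have "vmod q (fst Y) = vmod q (shear (-1) (f l') (shear 1 (f l) (fst M)))"
     "vmod q (snd Y) = vmod q (shear (-1) (f l') (shear 1 (f l) (snd M)))"
    using vmod_shear[OF vmod_vmod] by (simp_all add: act_def)
  note step = this[THEN vmod_shears, of "signed (map f ls)"]
  show ?case
    unfolding 3(1)[OF z Y(1) \<open>1 < q\<close>] using step by simp
qed simp

text \<open>A closed zigzag gives a word that fixes both columns of an invertible matrix modulo
  \<open>q\<close>, hence also \<open>(1, 0)\<close>. For a short word without equal neighbouring
  labels this contradicts \<open>shears_signed_nontrivial\<close>.\<close>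

lemma zigzag_act_girth:
  assumes z: "zigzag (\<lambda>l. act q 1 (f l)) (SL2 q) ls M M" and M: "M \<in> SL2 q"
    and ls: "ls \<noteq> []" "length ls \<le> L" "set ls \<subseteq> \<Lambda>" "inj_on f \<Lambda>" "f ` \<Lambda> \<subseteq> {0..<d}"
    and q: "(8 * (d + 1)\<^sup>2) ^ L < q"
  shows "\<not> distinct_adj ls"
proof
  assume adj: "distinct_adj ls"
  have "0 < d" using ls by (cases ls) auto
  then have "(1::int) \<le> (8 * (d + 1)\<^sup>2) ^ L"
    by (intro one_le_power) (use zero_less_power[of "d+1" 2] in linarith)
  then have q1: "1 < q" using q by linarith
  define W where "W = shears (signed (map f ls))"
  obtain a b c e where Me: "M = ((a, b), (c, e))" by (metis surj_pair)
  have fixed: "vmod q (W (a, b)) = vmod q (a, b)" "vmod q (W (c, e)) = vmod q (c, e)"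
    using zigzag_act[OF z M q1] SL2_vmod[OF M] by (auto simp: W_def Me)
  define D where "D = a * e - b * c"
  have D: "D mod q = 1" using M by (simp add: SL2_def Me D_def det2_def)
  \<comment> \<open>The coefficients come from the adjugate matrix: they combine the two columns
    into \<open>D\<close> times the first unit vector. The summand with coefficient 0 merely brings
    the right-hand side into the form \<open>lincomb\<close>.\<close>
  have "lincomb e (a, b) (- b) (c, e) = lincomb D (1, 0) 0 (0, 0)"
    by (simp add: lincomb_def D_def)
  then have "W (lincomb D (1, 0) 0 (0, 0)) = lincomb e (W (a, b)) (- b) (W (c, e))"
    unfolding W_def by (metis shears_lincomb)
  then have "lincomb D (W (1, 0)) 0 (W (0, 0)) = lincomb e (W (a, b)) (- b) (W (c, e))"
    unfolding W_def by (simp add: shears_lincomb)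
  then have "vmod q (lincomb D (W (1, 0)) 0 (W (0, 0))) = vmod q (lincomb e (a, b) (- b) (c, e))"
    using vmod_lincomb[OF fixed] by simp
  then have "q dvd D * snd (W (1, 0))"
    by (simp add: vmod_eq_iff lincomb_def algebra_simps)
  moreover have "coprime q D"
    using D q1 by (metis coprime_mod_right_iff coprime_1_right less_irrefl not_one_less_zero)
  ultimately have "q dvd snd (W (1, 0))"
    using coprime_dvd_mult_right_iff by blast
  moreover have "distinct_adj (map f ls)"
    using adj ls by (intro distinct_adj_mapI) (auto intro: inj_on_subset)
  ultimately show False
    using shears_signed_nontrivial[of "map f ls" d L q] ls q unfolding W_def by auto
qed


text \<open>The elements of \<open>SL2 q\<close> are renumbered by natural numbers; four entries
  below \<open>q\<close> give the fourth power. Since \<open>L\<close> occurs only as an exponent,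
  the bound on the logarithm of \<open>n\<close> grows linearly in \<open>L\<close>.\<close>

lemma ex_high_girth:
  fixes \<Lambda> :: "'l set"
  assumes "finite \<Lambda>"
  shows "\<exists>n (g :: 'l \<Rightarrow> nat \<Rightarrow> nat). 0 < n \<and> n \<le> ((8 * (card \<Lambda> + 1)\<^sup>2) ^ L + 1) ^ 4 \<and>
    (\<forall>l. bij_betw (g l) {..<n} {..<n}) \<and>
    (\<forall>ls x. ls \<noteq> [] \<longrightarrow> length ls \<le> L \<longrightarrow> set ls \<subseteq> \<Lambda> \<longrightarrow> x < n \<longrightarrow>
       zigzag g {..<n} ls x x \<longrightarrow> \<not> distinct_adj ls)"
proof -
  obtain f0 :: "'l \<Rightarrow> nat" where f0: "inj_on f0 \<Lambda>" "f0 ` \<Lambda> = {0..<card \<Lambda>}"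
    using ex_bij_betw_finite_nat[OF assms] by (auto simp: bij_betw_def)
  define f where "f l = int (f0 l)" for l
  define d where "d = int (card \<Lambda>)"
  have f: "inj_on f \<Lambda>" "f ` \<Lambda> \<subseteq> {0..<d}"
    using f0 by (auto simp: inj_on_def f_def d_def)
  define q where "q = (8 * (d + 1)\<^sup>2) ^ L + 1"
  have q: "(8 * (d + 1)\<^sup>2) ^ L < q" by (simp add: q_def)
  have "0 < (8 * (d + 1)\<^sup>2) ^ L" by (simp add: d_def)
  then have q1: "1 < q" by (simp add: q_def)
  define X where "X = SL2 q"
  have X_sub: "X \<subseteq> ({0..<q} \<times> {0..<q}) \<times> ({0..<q} \<times> {0..<q})"
    by (auto simp: X_def SL2_def)
  then have fin: "finite X" by (rule finite_subset) simp
  have "card X \<le> nat q * nat q * (nat q * nat q)"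
    using card_mono[OF _ X_sub] by simp
  also have "\<dots> = nat q ^ 4"
    by (simp only: power4_eq_xxxx mult.assoc)
  also have "q = int ((8 * (card \<Lambda> + 1)\<^sup>2) ^ L + 1)"
    by (simp add: q_def d_def add.commute)
  then have "nat q = (8 * (card \<Lambda> + 1)\<^sup>2) ^ L + 1"
    by (simp only: nat_int)
  finally have card: "card X \<le> ((8 * (card \<Lambda> + 1)\<^sup>2) ^ L + 1) ^ 4" .
  have "((1, 0), (0, 1)) \<in> X" using q1 by (simp add: X_def SL2_def det2_def)
  then have pos: "0 < card X" using fin card_gt_0_iff by blast
  obtain h where h: "bij_betw h {..<card X} X"
    using ex_bij_betw_nat_finite[OF fin] by (auto simp: atLeast0LessThan)
  define g where "g l x = inv_into {..<card X} h (act q 1 (f l) (h x))" for l x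
  have hX: "h x \<in> X" if "x < card X" for x
    using h that by (auto simp: bij_betw_def)
  have act_X: "act q 1 (f l) (h x) \<in> X" if "x < card X" for l x
    using act_in_SL2[OF q1] hX[OF that] by (simp add: X_def)
  have hg: "h (g l x) = act q 1 (f l) (h x)" if "x < card X" for l x
    using act_X[OF that] h unfolding g_def
    by (metis bij_betw_imp_surj_on f_inv_into_f)
  have g_less: "g l x < card X" if "x < card X" for l x
    using act_X[OF that] h unfolding g_def
    by (metis bij_betw_imp_surj_on inv_into_into lessThan_iff)
  have g_inj: "inj_on (g l) {..<card X}" for l
  proof (rule inj_onI)
    fix x y assume xy: "x \<in> {..<card X}" "y \<in> {..<card X}" "g l x = g l y"
    then have "act q 1 (f l) (h x) = act q 1 (f l) (h y)" using hg by (metis lessThan_iff)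
    then have "h x = h y" using act_inverse hX xy unfolding X_def by (metis lessThan_iff)
    then show "x = y" using h xy by (auto simp: bij_betw_def inj_on_def)
  qed
  have bij: "bij_betw (g l) {..<card X} {..<card X}" for l
    unfolding bij_betw_def using g_inj g_less endo_inj_surj[of "{..<card X}" "g l"] by auto
  have zz: "zigzag (\<lambda>l. act q 1 (f l)) X ls (h x) (h z)"
    if "zigzag g {..<card X} ls x z" "x < card X" for ls x z
    using that
  proof (induction ls arbitrary: x rule: induct_list012)
    case (3 l l' ls)
    then obtain y where y: "y < card X" "g l x = g l' y" "zigzag g {..<card X} ls y z" by auto
    then have "act q 1 (f l) (h x) = act q 1 (f l') (h y)" using hg 3 by metis
    then show ?case using 3(1)[OF y(3,1)] hX[OF y(1)] by auto
  qed auto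
  have "\<not> distinct_adj ls"
    if "ls \<noteq> []" "length ls \<le> L" "set ls \<subseteq> \<Lambda>" "x < card X" "zigzag g {..<card X} ls x x" for ls x
    using zigzag_act_girth[OF _ _ that(1-3) f q, of "h x"] zz[OF that(5,4)] hX[OF that(4)]
    by (simp add: X_def)
  then show ?thesis
    using pos card bij by (intro exI[of _ "card X"] exI[of _ g] conjI) (simp_all only: simp_thms, blast)
qed

subsection \<open>Gadgets\<close>

definition usym :: "('v \<times> 'v) set \<Rightarrow> ('v \<times> 'v) set" where
  "usym R = R \<union> R\<inverse>"

lemma usym_iff: "(u, v) \<in> usym R \<longleftrightarrow> (u, v) \<in> R \<or> (v, u) \<in> R"
  by (auto simp: usym_def)

lemma usym_relpow_commute: "(u, v) \<in> usym R ^^ m \<Longrightarrow> (v, u) \<in> usym R ^^ m"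
proof (induction m arbitrary: v)
  case (Suc m)
  then obtain w where "(u, w) \<in> usym R ^^ m" "(w, v) \<in> usym R" by auto
  then show ?case using Suc.IH by (meson relpow_Suc_I2 usym_iff)
qed simp

text \<open>The linear code over the field with two elements as a system of equations without time;
  rounds enter only with \<open>flow\<close>.\<close>

definition xor_flow :: "('v \<times> 'v) set \<Rightarrow> 'v set \<Rightarrow> ('v \<Rightarrow> bool) \<Rightarrow> bool" where
  "xor_flow E S val \<longleftrightarrow> (\<forall>v. v \<notin> S \<longrightarrow> val v = odd (card {u. (u, v) \<in> E \<and> val u}))"

text \<open>
  \<open>S\<close> is the set of sources and \<open>\<tau> s\<close> the sink of the session with source \<open>s\<close>. The number
  \<open>a\<close> bounds the time needed by the linear code, \<open>b\<close> the length of a source-sink walk that avoids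
  the cut \<open>F\<close>.
\<close>

locale gadget =
  fixes E F :: "('v \<times> 'v) set" and S :: "'v set" and \<tau> :: "'v \<Rightarrow> 'v" and a b :: nat
  assumes finite_arcs: "finite E"
    and cut_subset: "F \<subseteq> E"
    and finite_sources: "finite S"
    and no_arc_into_source: "(u, v) \<in> E \<Longrightarrow> v \<notin> S"
    and levels: "\<exists>lev :: 'v \<Rightarrow> nat. (\<forall>(u, v)\<in>E. lev u < lev v) \<and> (\<forall>s\<in>S. lev (\<tau> s) \<le> a)"
    and decode: "xor_flow E S val \<Longrightarrow> s \<in> S \<Longrightarrow> val (\<tau> s) = val s"
    and distance: "s \<in> S \<Longrightarrow> (s, \<tau> s) \<in> usym (E - F) ^^ m \<Longrightarrow> b \<le> m"
begin

lemma arc_irrefl: "(u, v) \<in> E \<Longrightarrow> u \<noteq> v"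
  using levels by fastforce

end

text \<open>One type holds the vertices of the base gadget and those of all products, so that
  products can be iterated. Countability allows the final renaming of vertices into natural
  numbers.\<close>

datatype vtx = Src nat | Snk nat | Relay nat | Hub bool
  | Outer nat vtx vtx | Inner nat vtx vtx vtx

instance vtx :: countable
  by countable_datatype

inductive_set base_arcs :: "nat \<Rightarrow> (vtx \<times> vtx) set" for k where
  "i < k \<Longrightarrow> (Src i, Hub False) \<in> base_arcs k"
| "(Hub False, Hub True) \<in> base_arcs k"
| "i < k \<Longrightarrow> (Hub True, Snk i) \<in> base_arcs k"
| "i < k \<Longrightarrow> j < k \<Longrightarrow> i \<noteq> j \<Longrightarrow> (Src i, Relay j) \<in> base_arcs k"
| "i < k \<Longrightarrow> (Relay i, Snk i) \<in> base_arcs k"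

fun base_sink :: "vtx \<Rightarrow> vtx" where
  "base_sink (Src i) = Snk i"
| "base_sink v = v"

fun base_level :: "vtx \<Rightarrow> nat" where
  "base_level (Src i) = 0"
| "base_level (Hub c) = (if c then 2 else 1)"
| "base_level (Relay i) = 1"
| "base_level v = 3"

text \<open>A lower bound for the distance from \<open>Src i\<close> once the arc between the two hubs is cut.\<close>

fun base_potential :: "nat \<Rightarrow> vtx \<Rightarrow> nat" where
  "base_potential i (Src l) = (if l = i then 0 else 2)"
| "base_potential i (Hub c) = (if c then 3 else 1)"
| "base_potential i (Relay l) = (if l = i then 3 else 1)"
| "base_potential i (Snk l) = (if l = i then 4 else 2)"
| "base_potential i v = 0"

lemma potential_relpow:
  assumes "\<And>u v. (u, v) \<in> R \<Longrightarrow> \<phi> v \<le> \<phi> u + (1::nat)" "(u, v) \<in> R ^^ m"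
  shows "\<phi> v \<le> \<phi> u + m"
  using assms(2)
proof (induction m arbitrary: v)
  case (Suc m)
  then show ?case using assms(1) by fastforce
qed simp

lemma base_arcs_subset:
  "base_arcs k \<subseteq> (\<lambda>i. (Src i, Hub False)) ` {..<k} \<union> {(Hub False, Hub True)} \<union>
     (\<lambda>i. (Hub True, Snk i)) ` {..<k} \<union> (\<lambda>(i, j). (Src i, Relay j)) ` ({..<k} \<times> {..<k}) \<union>
     (\<lambda>i. (Relay i, Snk i)) ` {..<k}"
  by (auto elim!: base_arcs.cases)

lemma finite_base_arcs: "finite (base_arcs k)"
  by (rule finite_subset[OF base_arcs_subset]) auto

lemma card_Un_le_add: "card A \<le> a \<Longrightarrow> card B \<le> b \<Longrightarrow> card (A \<union> B) \<le> a + b"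
  by (meson add_mono card_Un_le order_trans)

lemma card_image_bound: "finite A \<Longrightarrow> card A \<le> c \<Longrightarrow> card (f ` A) \<le> c"
  using card_image_le order_trans by blast

lemma card_base_arcs: "card (base_arcs k) \<le> k * k + 3 * k + 1"
proof -
  have "card (base_arcs k) \<le> k + 1 + k + k * k + k"
    by (rule order_trans[OF card_mono[OF _ base_arcs_subset]], (simp; fail),
        intro card_Un_le_add card_image_bound) simp_all
  then show ?thesis by simp
qed

lemma gadget_base: "gadget (base_arcs k) {(Hub False, Hub True)} (Src ` {..<k}) base_sink 3 4"
proof
  show "finite (base_arcs k)" by (rule finite_base_arcs)
  show "\<exists>lev::vtx \<Rightarrow> nat. (\<forall>(u, v)\<in>base_arcs k. lev u < lev v) \<and> (\<forall>s\<in>Src ` {..<k}. lev (base_sink s) \<le> 3)"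
    by (rule exI[of _ base_level]) (auto elim!: base_arcs.cases)
  fix s assume s: "s \<in> Src ` {..<k}"
  then obtain i where i: "s = Src i" "i < k" by auto
  {
    fix m assume walk: "(s, base_sink s) \<in> usym (base_arcs k - {(Hub False, Hub True)}) ^^ m"
    have "base_potential i v \<le> base_potential i u + 1"
      if "(u, v) \<in> usym (base_arcs k - {(Hub False, Hub True)})" for u v
      using that unfolding usym_iff by (auto elim!: base_arcs.cases split: if_splits)
    from potential_relpow[where \<phi> = "base_potential i", OF this walk] show "4 \<le> m" by (simp add: i)
  }
  {
    fix val assume "xor_flow (base_arcs k) (Src ` {..<k}) val"
    then have flow: "v \<notin> Src ` {..<k} \<Longrightarrow> val v = odd (card {u. (u, v) \<in> base_arcs k \<and> val u})" for v
      by (simp add: xor_flow_def)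
    \<comment> \<open>\<open>P\<close> collects the sessions with source bit 1. The hubs carry the
      parity of \<open>card P\<close>, the relay \<open>i\<close> that of
      \<open>card (P - {i})\<close>, and their sum at the sink tells whether
      \<open>i \<in> P\<close>.\<close>
    define P where "P = {i. i < k \<and> val (Src i)}"
    have fin: "finite P" by (simp add: P_def)
    have inj: "inj_on Src A" for A by (simp add: inj_on_def)
    have "{u. (u, Hub False) \<in> base_arcs k \<and> val u} = Src ` P"
      by (auto simp: P_def elim: base_arcs.cases intro: base_arcs.intros)
    then have 1: "val (Hub False) = odd (card P)"
      using flow[of "Hub False"] by (simp add: card_image[OF inj] image_iff)
    have "(u, Hub True) \<in> base_arcs k \<longleftrightarrow> u = Hub False" for u
      by (auto elim: base_arcs.cases intro: base_arcs.intros)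
    then have 2: "val (Hub True) = val (Hub False)"
      using flow[of "Hub True"] by (simp add: Collect_conv_if image_iff)
    have "{u. (u, Relay i) \<in> base_arcs k \<and> val u} = Src ` (P - {i})"
      using i by (auto simp: P_def elim: base_arcs.cases intro: base_arcs.intros)
    then have 3: "val (Relay i) = odd (card (P - {i}))"
      using flow[of "Relay i"] by (simp add: card_image[OF inj] image_iff)
    have "(u, Snk i) \<in> base_arcs k \<longleftrightarrow> u = Hub True \<or> u = Relay i" for u
      using i by (auto elim: base_arcs.cases intro: base_arcs.intros)
    then have "{u. (u, Snk i) \<in> base_arcs k \<and> val u} =
        (if val (Hub True) then {Hub True} else {}) \<union> (if val (Relay i) then {Relay i} else {})"
      by auto
    then have 4: "val (Snk i) = (val (Hub True) \<noteq> val (Relay i))"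
      using flow[of "Snk i"] by (auto split: if_splits)
    have "odd (card P) \<noteq> odd (card (P - {i})) \<longleftrightarrow> i \<in> P"
      using card_Suc_Diff1[OF fin, of i] by (cases "i \<in> P") (metis even_Suc, simp)
    then have "val (Snk i) = (i \<in> P)"
      unfolding 4 2 1 3 .
    then show "val (base_sink s) = val s" using i by (simp add: P_def)
  }
qed (auto elim: base_arcs.cases intro: base_arcs.intros)

subsection \<open>Products of gadgets\<close>

lemma not_distinct_adjE:
  assumes "\<not> distinct_adj xs"
  obtains ys y zs where "xs = ys @ y # y # zs"
proof -
  have "\<exists>ys y zs. xs = ys @ y # y # zs"
    using assms
  proof (induction xs rule: induct_list012)
    case (3 x y zs)
    show ?case
    proof (cases "x = y")
      case False
      then have "\<not> distinct_adj (y # zs)" using 3 by simp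
      then obtain us u vs where "y # zs = us @ u # u # vs" using 3(2) by blast
      then have "x # y # zs = (x # us) @ u # u # vs" by simp
      then show ?thesis by blast
    next
      case True
      then have "x # y # zs = [] @ y # y # zs" by simp
      then show ?thesis by blast
    qed
  qed simp_all
  then show thesis using that by blast
qed

text \<open>
  Every arc \<open>(u, v)\<close> outside the cut of the first gadget is replaced by a session of a copy of
  the second gadget. The copy \<open>(x, j)\<close> of the first gadget uses for this purpose the session \<open>j\<close> of
  the copy \<open>(g (u, v, j) x, u, v)\<close> of the second one.
\<close>

locale gadget_product = G1: gadget E1 F1 S1 \<tau>1 a1 b1 + G2: gadget E2 F2 S2 \<tau>2 a2 b2
  for E1 F1 :: "(vtx \<times> vtx) set" and S1 :: "vtx set" and \<tau>1 a1 b1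
    and E2 F2 :: "(vtx \<times> vtx) set" and S2 :: "vtx set" and \<tau>2 a2 b2 +
  fixes n :: nat and g :: "vtx \<times> vtx \<times> vtx \<Rightarrow> nat \<Rightarrow> nat"
  assumes bij: "bij_betw (g l) {..<n} {..<n}"
    and girth: "\<lbrakk>ls \<noteq> []; length ls \<le> b1 * (b2 + 2); set ls \<subseteq> {(u, v, j). (u, v) \<in> E1 - F1 \<and> j \<in> S2};
      x < n; zigzag g {..<n} ls x x\<rbrakk> \<Longrightarrow> \<not> distinct_adj ls"
begin

inductive_set prod_arcs where
  enter: "x < n \<Longrightarrow> (u, v) \<in> E1 - F1 \<Longrightarrow> j \<in> S2 \<Longrightarrow> (Outer x j u, Inner (g (u, v, j) x) u v j) \<in> prod_arcs"
| leave: "x < n \<Longrightarrow> (u, v) \<in> E1 - F1 \<Longrightarrow> j \<in> S2 \<Longrightarrow> (Inner (g (u, v, j) x) u v (\<tau>2 j), Outer x j v) \<in> prod_arcs"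
| inner: "y < n \<Longrightarrow> (u, v) \<in> E1 - F1 \<Longrightarrow> (p, q) \<in> E2 \<Longrightarrow> (Inner y u v p, Inner y u v q) \<in> prod_arcs"
| bypass: "x < n \<Longrightarrow> j \<in> S2 \<Longrightarrow> (u, v) \<in> F1 \<Longrightarrow> (Outer x j u, Outer x j v) \<in> prod_arcs"

text \<open>Only walks that avoid the cut have to be long, so the arcs of \<open>F1\<close> stay
  single arcs and join the cuts of the inner copies.\<close>

inductive_set prod_cut where
  "y < n \<Longrightarrow> (u, v) \<in> E1 - F1 \<Longrightarrow> (p, q) \<in> F2 \<Longrightarrow> (Inner y u v p, Inner y u v q) \<in> prod_cut"
| "x < n \<Longrightarrow> j \<in> S2 \<Longrightarrow> (u, v) \<in> F1 \<Longrightarrow> (Outer x j u, Outer x j v) \<in> prod_cut"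

definition prod_sources :: "vtx set" where
  "prod_sources = (\<lambda>(x, j, s). Outer x j s) ` ({..<n} \<times> S2 \<times> S1)"

fun prod_sink :: "vtx \<Rightarrow> vtx" where
  "prod_sink (Outer x j s) = Outer x j (\<tau>1 s)"
| "prod_sink v = v"

lemma g_less: "x < n \<Longrightarrow> g l x < n"
  using bij[of l] by (auto simp: bij_betw_def)

lemma g_eq: "g l x = g l y \<Longrightarrow> x < n \<Longrightarrow> y < n \<Longrightarrow> x = y"
  using bij[of l] by (auto simp: bij_betw_def inj_on_def)

section \<open>Size of the product\<close>

lemma arcs_subset: "prod_arcs \<subseteq>
   (\<lambda>((u, v), x, j). (Outer x j u, Inner (g (u, v, j) x) u v j)) ` ((E1 - F1) \<times> {..<n} \<times> S2) \<union>
   (\<lambda>((u, v), x, j). (Inner (g (u, v, j) x) u v (\<tau>2 j), Outer x j v)) ` ((E1 - F1) \<times> {..<n} \<times> S2) \<union>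
   (\<lambda>((u, v), y, (p, q)). (Inner y u v p, Inner y u v q)) ` ((E1 - F1) \<times> {..<n} \<times> E2) \<union>
   (\<lambda>((u, v), x, j). (Outer x j u, Outer x j v)) ` (F1 \<times> {..<n} \<times> S2)"
  (is "_ \<subseteq> ?A \<union> ?B \<union> ?C \<union> ?D")
proof (rule subrelI)
  fix p q assume "(p, q) \<in> prod_arcs"
  then show "(p, q) \<in> ?A \<union> ?B \<union> ?C \<union> ?D"
  proof cases
    case (enter x u v j)
    then have "(p, q) \<in> ?A" by (intro image_eqI[of _ _ "((u, v), x, j)"]) auto
    then show ?thesis by blast
  next
    case (leave x u v j)
    then have "(p, q) \<in> ?B" by (intro image_eqI[of _ _ "((u, v), x, j)"]) auto
    then show ?thesis by blast
  next
    case (inner y u v p' q')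
    then have "(p, q) \<in> ?C" by (intro image_eqI[of _ _ "((u, v), y, (p', q'))"]) auto
    then show ?thesis by blast
  next
    case (bypass x j u v)
    then have "(p, q) \<in> ?D" by (intro image_eqI[of _ _ "((u, v), x, j)"]) auto
    then show ?thesis by blast
  qed
qed

lemma cut_subset_images: "prod_cut \<subseteq>
   (\<lambda>((u, v), y, (p, q)). (Inner y u v p, Inner y u v q)) ` ((E1 - F1) \<times> {..<n} \<times> F2) \<union>
   (\<lambda>((u, v), x, j). (Outer x j u, Outer x j v)) ` (F1 \<times> {..<n} \<times> S2)"
  (is "_ \<subseteq> ?C \<union> ?D")
proof (rule subrelI)
  fix p q assume "(p, q) \<in> prod_cut"
  then show "(p, q) \<in> ?C \<union> ?D"
  proof cases
    case (1 y u v p' q')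
    then have "(p, q) \<in> ?C" by (intro image_eqI[of _ _ "((u, v), y, (p', q'))"]) auto
    then show ?thesis by blast
  next
    case (2 x j u v)
    then have "(p, q) \<in> ?D" by (intro image_eqI[of _ _ "((u, v), x, j)"]) auto
    then show ?thesis by blast
  qed
qed

lemma finite_cuts: "finite F1" "finite F2"
  using G1.finite_arcs G1.cut_subset G2.finite_arcs G2.cut_subset finite_subset by blast+

lemmas finites [simp] = finite_cuts G1.finite_arcs G2.finite_arcs G1.finite_sources G2.finite_sources

lemma finite_prod_arcs: "finite prod_arcs"
  by (rule finite_subset[OF arcs_subset]) simp

lemma card_prod_arcs:
  "card prod_arcs \<le> n * (2 * (card (E1 - F1) * card S2) + card (E1 - F1) * card E2 + card F1 * card S2)"
proof -
  have "card prod_arcs \<le> card (E1 - F1) * (n * card S2) + card (E1 - F1) * (n * card S2) +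
     card (E1 - F1) * (n * card E2) + card F1 * (n * card S2)"
    by (rule order_trans[OF card_mono[OF _ arcs_subset]], (simp; fail),
        intro card_Un_le_add card_image_bound) (simp_all add: card_cartesian_product)
  then show ?thesis by (simp add: algebra_simps)
qed

lemma card_prod_cut: "card prod_cut \<le> n * (card (E1 - F1) * card F2 + card F1 * card S2)"
proof -
  have "card prod_cut \<le> card (E1 - F1) * (n * card F2) + card F1 * (n * card S2)"
    by (rule order_trans[OF card_mono[OF _ cut_subset_images]], (simp; fail),
        intro card_Un_le_add card_image_bound) (simp_all add: card_cartesian_product)
  then show ?thesis by (simp add: algebra_simps)
qed

lemma card_prod_sources: "card prod_sources = n * card S2 * card S1"
  unfolding prod_sources_def by (subst card_image) (auto simp: inj_on_def card_cartesian_product)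

section \<open>The composed code\<close>

text \<open>Arcs from outside enter an inner copy only at vertices of \<open>S2\<close>, so the
  equations of the second gadget hold unchanged at all its other vertices.\<close>

lemma inner_decode:
  assumes flow: "xor_flow prod_arcs prod_sources val" and y: "y < n" and uv: "(u, v) \<in> E1 - F1" and j: "j \<in> S2"
  shows "val (Inner y u v (\<tau>2 j)) = val (Inner y u v j)"
proof -
  have "xor_flow E2 S2 (\<lambda>p. val (Inner y u v p))"
    unfolding xor_flow_def
  proof (intro allI impI)
    fix p assume p: "p \<notin> S2"
    have "{w. (w, Inner y u v p) \<in> prod_arcs \<and> val w} = Inner y u v ` {q. (q, p) \<in> E2 \<and> val (Inner y u v q)}"
      using y uv p by (auto elim: prod_arcs.cases intro: prod_arcs.intros)
    moreover have "inj_on (Inner y u v) A" for A by (simp add: inj_on_def)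
    ultimately have "card {w. (w, Inner y u v p) \<in> prod_arcs \<and> val w} = card {q. (q, p) \<in> E2 \<and> val (Inner y u v q)}"
      by (simp add: card_image)
    moreover have "Inner y u v p \<notin> prod_sources" by (auto simp: prod_sources_def)
    ultimately show "val (Inner y u v p) = odd (card {q. (q, p) \<in> E2 \<and> val (Inner y u v q)})"
      using flow by (simp add: xor_flow_def)
  qed
  from G2.decode[OF this j] show ?thesis .
qed

text \<open>By injectivity of \<open>g (u, v, j)\<close> a source of an inner copy is fed by one
  outer copy only, and \<open>E2\<close> has no arc into a source; hence there is a single
  predecessor whose bit is taken over.\<close>

lemma entered_value:
  assumes flow: "xor_flow prod_arcs prod_sources val" and x: "x < n" and uv: "(u, v) \<in> E1 - F1" and j: "j \<in> S2"
  shows "val (Inner (g (u, v, j) x) u v j) = val (Outer x j u)"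
proof -
  let ?p = "Inner (g (u, v, j) x) u v j"
  have "(w, ?p) \<in> prod_arcs \<longleftrightarrow> w = Outer x j u" for w
    using x uv j by (auto elim!: prod_arcs.cases intro: prod_arcs.intros dest: g_eq G2.no_arc_into_source)
  moreover have "?p \<notin> prod_sources" by (auto simp: prod_sources_def)
  ultimately show ?thesis
    using flow unfolding xor_flow_def by (simp add: Collect_conv_if)
qed

lemma outer_flow:
  assumes flow: "xor_flow prod_arcs prod_sources val" and x: "x < n" and j: "j \<in> S2"
  shows "xor_flow E1 S1 (\<lambda>u. val (Outer x j u))"
  unfolding xor_flow_def
proof (intro allI impI)
  fix v assume v: "v \<notin> S1"
  \<comment> \<open>\<open>f u\<close> is the in-neighbour of \<open>Outer x j v\<close> that
    delivers the bit of \<open>u\<close>: the vertex itself if the arc was kept, otherwise the sink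
    of the session that replaces the arc.\<close>
  define f where "f u = (if (u, v) \<in> F1 then Outer x j u else Inner (g (u, v, j) x) u v (\<tau>2 j))" for u
  have val_f: "val (f u) = val (Outer x j u)" if "(u, v) \<in> E1" for u
    using that inner_decode[OF flow g_less[OF x] _ j, of u v] entered_value[OF flow x _ j, of u v]
    by (simp add: f_def)
  have "{w. (w, Outer x j v) \<in> prod_arcs} = f ` {u. (u, v) \<in> E1}"
    using x j G1.cut_subset unfolding f_def by (auto elim!: prod_arcs.cases intro: prod_arcs.intros simp: image_iff)
  then have "{w. (w, Outer x j v) \<in> prod_arcs \<and> val w} = {w \<in> f ` {u. (u, v) \<in> E1}. val w}"
    by blast
  also have "\<dots> = f ` {u. (u, v) \<in> E1 \<and> val (Outer x j u)}"
    using val_f by auto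
  finally have "{w. (w, Outer x j v) \<in> prod_arcs \<and> val w} = f ` {u. (u, v) \<in> E1 \<and> val (Outer x j u)}" .
  moreover have "inj_on f A" for A by (auto simp: inj_on_def f_def split: if_splits)
  ultimately have "card {w. (w, Outer x j v) \<in> prod_arcs \<and> val w} = card {u. (u, v) \<in> E1 \<and> val (Outer x j u)}"
    by (simp add: card_image)
  moreover have "Outer x j v \<notin> prod_sources" using v by (auto simp: prod_sources_def)
  ultimately show "val (Outer x j v) = odd (card {u. (u, v) \<in> E1 \<and> val (Outer x j u)})"
    using flow by (simp add: xor_flow_def)
qed

lemma prod_levels:
  "\<exists>lev :: vtx \<Rightarrow> nat. (\<forall>(u, v)\<in>prod_arcs. lev u < lev v) \<and> (\<forall>s\<in>prod_sources. lev (prod_sink s) \<le> a1 * (a2 + 2))"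
proof -
  obtain l1 l2 :: "vtx \<Rightarrow> nat"
    where l1: "\<And>u v. (u, v) \<in> E1 \<Longrightarrow> l1 u < l1 v" "\<And>s. s \<in> S1 \<Longrightarrow> l1 (\<tau>1 s) \<le> a1"
      and l2: "\<And>u v. (u, v) \<in> E2 \<Longrightarrow> l2 u < l2 v" "\<And>s. s \<in> S2 \<Longrightarrow> l2 (\<tau>2 s) \<le> a2"
    using G1.levels G2.levels by fast
  \<comment> \<open>An outer arc is given \<open>a2 + 2\<close> levels: one to enter the inner copy,
    \<open>a2\<close> inside it and one to leave.\<close>
  define lev where "lev p = (case p of Outer x j u \<Rightarrow> l1 u * (a2 + 2)
    | Inner y u v q \<Rightarrow> l1 u * (a2 + 2) + 1 + l2 q | _ \<Rightarrow> 0)" for p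
  have step: "l1 u * (a2 + 2) + (a2 + 2) \<le> l1 v * (a2 + 2)" if "(u, v) \<in> E1" for u v
    using mult_le_mono1[of "Suc (l1 u)" "l1 v" "a2 + 2"] l1(1)[OF that] by simp
  have "lev u < lev v" if "(u, v) \<in> prod_arcs" for u v
    using that
  proof cases
    case (leave x u v j)
    then show ?thesis using step[of u v] l2(2)[of j] by (simp add: lev_def)
  next
    case (bypass x j u v)
    then show ?thesis using step[of u v] G1.cut_subset by (auto simp: lev_def)
  qed (use l2 in \<open>auto simp: lev_def\<close>)
  moreover have "lev (prod_sink s) \<le> a1 * (a2 + 2)" if s: "s \<in> prod_sources" for s
  proof -
    obtain x j s' where s': "s = Outer x j s'" "s' \<in> S1" using s by (auto simp: prod_sources_def)
    then have "l1 (\<tau>1 s') * (a2 + 2) \<le> a1 * (a2 + 2)" by (intro mult_le_mono1 l1(2))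
    then show ?thesis unfolding s' lev_def prod_sink.simps vtx.case .
  qed
  ultimately show ?thesis by (intro exI[of _ lev]) auto
qed


section \<open>Short walks in the product\<close>

text \<open>A weighted substitute for a walk that begins and ends in the same copy. A step in a copy
  of the first gadget weighs \<open>b2 + 2\<close>, the price of entering, traversing a session and
  leaving. In a copy of the second gadget weight \<open>b2\<close> permits a jump between any two
  vertices: only the lower bound \<open>b2\<close> between source and sink is ever used, and this
  freedom allows detours through outer copies to be absorbed.\<close>

definition segment :: "nat \<Rightarrow> vtx \<Rightarrow> vtx \<Rightarrow> bool" where
  "segment w P Q \<longleftrightarrow>
     (\<exists>x j u v m. P = Outer x j u \<and> Q = Outer x j v \<and>
        (u, v) \<in> usym (E1 - F1) ^^ m \<and> m * (b2 + 2) \<le> w) \<or>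
     (\<exists>y u v p q. P = Inner y u v p \<and> Q = Inner y u v q \<and>
        (b2 \<le> w \<or> (\<exists>m\<le>w. (p, q) \<in> usym (E2 - F2) ^^ m)))"

text \<open>In each outer copy a label \<open>(u, v, j)\<close> has two crossing arcs;
  \<open>c\<close> selects the one at the tail \<open>u\<close> (source side) or at the head
  \<open>v\<close> (sink side). \<open>port\<close> is the outer end of the arc and
  \<open>iport\<close> the inner end.\<close>

definition port :: "bool \<Rightarrow> vtx \<times> vtx \<times> vtx \<Rightarrow> nat \<Rightarrow> vtx" where
  "port c l x = (case l of (u, v, j) \<Rightarrow> Outer x j (if c then v else u))"

definition iport :: "bool \<Rightarrow> vtx \<times> vtx \<times> vtx \<Rightarrow> nat \<Rightarrow> vtx" where
  "iport c l x = (case l of (u, v, j) \<Rightarrow> Inner (g l x) u v (if c then \<tau>2 j else j))"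

definition cross :: "vtx \<times> vtx \<times> vtx \<Rightarrow> vtx \<Rightarrow> vtx \<Rightarrow> bool" where
  "cross l P Q \<longleftrightarrow> (\<exists>x<n. \<exists>c. (P = port c l x \<and> Q = iport c l x) \<or> (Q = port c l x \<and> P = iport c l x))"

abbreviation labels :: "(vtx \<times> vtx \<times> vtx) set" where
  "labels \<equiv> {(u, v, j). (u, v) \<in> E1 - F1 \<and> j \<in> S2}"

text \<open>
  A route records the labels of the arcs along which a walk crosses between copies of the two
  gadgets. Since a segment may be lighter than the walk it stands for, a detour into another
  copy that returns through the arc it came from can be absorbed in a segment.
\<close>

primrec route :: "(vtx \<times> vtx \<times> vtx) list \<Rightarrow> nat \<Rightarrow> vtx \<Rightarrow> vtx \<Rightarrow> bool" where
  "route [] w P Q \<longleftrightarrow> segment w P Q"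
| "route (l # ls) w P Q \<longleftrightarrow> (\<exists>w1 w2 P' Q'. w1 + 1 + w2 \<le> w \<and>
     segment w1 P P' \<and> cross l P' Q' \<and> route ls w2 Q' Q)"

lemma segment_trans: "segment v P Q \<Longrightarrow> segment w Q R \<Longrightarrow> segment (v + w) P R"
proof -
  assume PQ: "segment v P Q" and QR: "segment w Q R"
  consider (outer) x j u u' m where "P = Outer x j u" "Q = Outer x j u'"
      "(u, u') \<in> usym (E1 - F1) ^^ m" "m * (b2 + 2) \<le> v"
    | (inner) y u u' p q where "P = Inner y u u' p" "Q = Inner y u u' q"
      "b2 \<le> v \<or> (\<exists>m\<le>v. (p, q) \<in> usym (E2 - F2) ^^ m)"
    using PQ unfolding segment_def by blast
  then show ?thesis
  proof cases
    case outer
    then obtain u'' m' where R: "R = Outer x j u''"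
      and m': "(u', u'') \<in> usym (E1 - F1) ^^ m'" "m' * (b2 + 2) \<le> w"
      using QR unfolding segment_def by auto
    have "(u, u'') \<in> usym (E1 - F1) ^^ (m + m')"
      using outer(3) m'(1) by (auto simp: relpow_add)
    moreover have "(m + m') * (b2 + 2) \<le> v + w"
      unfolding add_mult_distrib using outer(4) m'(2) by (rule add_mono)
    ultimately show ?thesis
      using outer(1) R unfolding segment_def by blast
  next
    case inner
    then obtain r where R: "R = Inner y u u' r"
      and r: "b2 \<le> w \<or> (\<exists>m\<le>w. (q, r) \<in> usym (E2 - F2) ^^ m)"
      using QR unfolding segment_def by auto
    have "b2 \<le> v + w \<or> (\<exists>m\<le>v + w. (p, r) \<in> usym (E2 - F2) ^^ m)"
    proof (cases "b2 \<le> v \<or> b2 \<le> w")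
      case False
      then obtain m m' where "m \<le> v" "m' \<le> w" "(p, q) \<in> usym (E2 - F2) ^^ m" "(q, r) \<in> usym (E2 - F2) ^^ m'"
        using inner(3) r by blast
      then have "m + m' \<le> v + w" "(p, r) \<in> usym (E2 - F2) ^^ (m + m')"
        by (auto simp: relpow_add)
      then show ?thesis by blast
    qed auto
    then show ?thesis using inner(1) R unfolding segment_def by blast
  qed
qed

lemma segment_refl [simp]: "segment w (Outer x j u) (Outer x j u)" "segment w (Inner y u v p) (Inner y u v p)"
  unfolding segment_def by (auto intro!: exI[of _ 0])

lemma segment_mono: "segment w P Q \<Longrightarrow> w \<le> w' \<Longrightarrow> segment w' P Q"
proof -
  assume PQ: "segment w P Q" and w: "w \<le> w'"
  have "segment (w' - w) Q Q"
    using PQ by (auto simp: segment_def[of w])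
  from segment_trans[OF PQ this] w show ?thesis by simp
qed

lemma segment_port_refl [simp]: "segment w (port c l x) (port c l x)" "segment w (iport c l x) (iport c l x)"
  by (auto simp: port_def iport_def split: prod.split)

lemma segment_ports:
  assumes "segment w (port c l x) (port c' l x')" "l \<in> labels"
  shows "x = x'" "c \<noteq> c' \<Longrightarrow> b2 \<le> w"
proof -
  obtain u v j where l: "l = (u, v, j)" "(u, v) \<in> E1" using assms(2) by auto
  show "x = x'" using assms(1) by (auto simp: l segment_def port_def)
  assume "c \<noteq> c'"
  obtain m where m: "(if c then v else u, if c' then v else u) \<in> usym (E1 - F1) ^^ m" "m * (b2 + 2) \<le> w"
    using assms(1) unfolding l segment_def port_def prod.case vtx.inject by blast
  have "m \<noteq> 0"
    using m(1) G1.arc_irrefl[OF l(2)] \<open>c \<noteq> c'\<close> by (intro notI) (auto split: if_splits)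
  then have "1 * (b2 + 2) \<le> m * (b2 + 2)"
    by (intro mult_le_mono1) simp
  then have "1 * (b2 + 2) \<le> w" using m(2) by (rule order_trans)
  then show "b2 \<le> w" by simp
qed

lemma segment_iports:
  assumes "segment w (iport c l x) (iport c' l x')" "l \<in> labels" "x < n" "x' < n"
  shows "x = x'" "c \<noteq> c' \<Longrightarrow> b2 \<le> w"
proof -
  obtain u v j where l: "l = (u, v, j)" "j \<in> S2" using assms(2) by auto
  have "g l x = g l x'" using assms(1) by (auto simp: l segment_def iport_def)
  then show "x = x'" using g_eq assms by blast
  assume "c \<noteq> c'"
  have "b2 \<le> w \<or> (\<exists>m\<le>w. (if c then \<tau>2 j else j, if c' then \<tau>2 j else j) \<in> usym (E2 - F2) ^^ m)"
    using assms(1) unfolding l segment_def iport_def prod.case by auto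
  then show "b2 \<le> w"
  proof
    assume "\<exists>m\<le>w. (if c then \<tau>2 j else j, if c' then \<tau>2 j else j) \<in> usym (E2 - F2) ^^ m"
    then obtain m where "m \<le> w" "(j, \<tau>2 j) \<in> usym (E2 - F2) ^^ m"
      using \<open>c \<noteq> c'\<close> by (cases c; cases c') (auto dest: usym_relpow_commute)
    then show ?thesis using G2.distance[OF l(2), of m] by linarith
  qed
qed

lemma segment_port_port:
  assumes "l \<in> labels" "b2 \<le> w"
  shows "segment (w + 2) (port c l x) (port c' l x)"
proof -
  obtain u v j where l: "l = (u, v, j)" "(u, v) \<in> E1 - F1" using assms(1) by auto
  have "(if c then v else u, if c' then v else u) \<in> usym (E1 - F1) ^^ (if c = c' then 0 else 1)"
    using l(2) by (auto simp: usym_iff)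
  moreover have "(if c = c' then 0 else 1) * (b2 + 2) \<le> w + 2" using assms(2) by simp
  ultimately show ?thesis unfolding segment_def l port_def prod.case by blast
qed

lemma segment_iport_iport: "b2 \<le> w \<Longrightarrow> segment w (iport c l x) (iport c' l x)"
  unfolding segment_def iport_def by (auto split: prod.split)

text \<open>Injectivity of \<open>g l\<close> brings a detour that leaves and returns through the
  same label back to the same copy. If it returns at the end where it left, nothing has moved.
  Otherwise its middle part weighs at least \<open>b2\<close>, and with the two crossings this pays
  for one outer step of weight \<open>b2 + 2\<close> or for a jump in the inner copy.\<close>

lemma spur:
  assumes "cross l P Q" "segment w Q Q'" "cross l Q' P'" "l \<in> labels"
  shows "segment (w + 2) P P'"
proof -
  obtain x c where x: "x < n" and PQ: "(P = port c l x \<and> Q = iport c l x) \<or> (Q = port c l x \<and> P = iport c l x)"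
    using assms(1) unfolding cross_def by blast
  obtain x' c' where x': "x' < n"
    and PQ': "(Q' = port c' l x' \<and> P' = iport c' l x') \<or> (P' = port c' l x' \<and> Q' = iport c' l x')"
    using assms(3) unfolding cross_def by blast
  have mixed: "\<not> segment w (port c l x) (iport c' l x')" "\<not> segment w (iport c l x) (port c' l x')"
    by (auto simp: segment_def port_def iport_def split: prod.splits)
  show ?thesis
  proof (cases "Q = iport c l x")
    case True
    then have eqs: "P = port c l x" "Q' = iport c' l x'" "P' = port c' l x'"
      using PQ PQ' mixed assms(2) by (auto simp: port_def iport_def split: prod.splits)
    have seg: "segment w (iport c l x) (iport c' l x')" using assms(2) True eqs by simp
    note segment_iports[OF seg assms(4) x x']
    then show ?thesis
      unfolding eqs using segment_port_port[OF assms(4)] by (cases "c = c'") auto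
  next
    case False
    then have eqs: "Q = port c l x" "P = iport c l x" "Q' = port c' l x'" "P' = iport c' l x'"
      using PQ PQ' mixed assms(2) by auto
    have seg: "segment w (port c l x) (port c' l x')" using assms(2) eqs by simp
    note segment_ports[OF seg assms(4)]
    then show ?thesis
      unfolding eqs using segment_iport_iport[of "w + 2"] by (cases "c = c'") auto
  qed
qed

lemma segment_route: "segment v P Q \<Longrightarrow> route ls w Q R \<Longrightarrow> route ls (v + w) P R"
proof (cases ls)
  case Nil
  then show "segment v P Q \<Longrightarrow> route ls w Q R \<Longrightarrow> ?thesis" by (simp add: segment_trans)
next
  case (Cons l ls')
  assume PQ: "segment v P Q" and "route ls w Q R"
  then obtain w1 w2 P' Q' where *: "w1 + 1 + w2 \<le> w" "segment w1 Q P'" "cross l P' Q'" "route ls' w2 Q' R"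
    by (auto simp: Cons)
  have "segment (v + w1) P P'" using PQ *(2) by (rule segment_trans)
  moreover have "(v + w1) + 1 + w2 \<le> v + w" using *(1) by simp
  ultimately show ?thesis using *(3,4) unfolding Cons route.simps by blast
qed

lemma route_mono: "route ls w P Q \<Longrightarrow> w \<le> w' \<Longrightarrow> route ls w' P Q"
  by (cases ls) (auto intro: segment_mono dest: order_trans)

text \<open>Crossing, segment and crossing are merged by \<open>spur\<close> into one segment whose
  weight is exactly what they cost, so the total weight does not grow.\<close>

lemma route_remove_spur:
  assumes "route (ks @ l # l # ls) w P R" "l \<in> labels"
  shows "route (ks @ ls) w P R"
  using assms(1)
proof (induction ks arbitrary: w P)
  case Nil
  then obtain w1 v P' Q' where 1: "w1 + 1 + v \<le> w" "segment w1 P P'" "cross l P' Q'"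
    "route (l # ls) v Q' R"
    unfolding append_Nil route.simps(2)[of l "l # ls"] by blast
  obtain w2 w3 Q'' P'' where 2: "w2 + 1 + w3 \<le> v"
    "segment w2 Q' Q''" "cross l Q'' P''" "route ls w3 P'' R"
    using 1(4) unfolding route.simps(2) by blast
  have *: "w1 + 1 + w2 + 1 + w3 \<le> w" "segment w1 P P'" "cross l P' Q'"
    "segment w2 Q' Q''" "cross l Q'' P''" "route ls w3 P'' R"
    using 1 2 by auto
  have "route ls (w2 + 2 + w3) P' R"
    using spur[OF *(3-5) assms(2)] *(6) by (rule segment_route)
  with *(2) have "route ls (w1 + (w2 + 2 + w3)) P R" by (rule segment_route)
  then show ?case using *(1) by (auto intro: route_mono)
next
  case (Cons k ks)
  then show ?case by auto blast
qed

lemma length_route: "route ls w P Q \<Longrightarrow> length ls \<le> w"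
proof (induction ls arbitrary: w P)
  case (Cons l ls)
  then show ?case by fastforce
qed simp

lemma cross_outerD: "cross (u, v, j) (Outer x i p) Q \<Longrightarrow>
    x < n \<and> (\<exists>q. Q = Inner (g (u, v, j) x) u v q)"
  by (auto simp: cross_def port_def iport_def)

lemma cross_innerD: "cross (u, v, j) (Inner y u' v' p) Q \<Longrightarrow>
    \<exists>x<n. \<exists>i q. Q = Outer x i q \<and> y = g (u, v, j) x"
  by (auto simp: cross_def port_def iport_def)

text \<open>Crossing at label \<open>l\<close> leads from the outer copy \<open>x\<close> to an
  inner copy with index \<open>g l x\<close> or back, while segments keep the index of the copy. The
  indices therefore perform a zigzag.\<close>

lemma route_zigzag:
  assumes "route ls w (Outer x j u) (Outer x' j' u')"
  shows "zigzag g {..<n} ls x x'"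
  using assms
proof (induction ls arbitrary: w x j u rule: induct_list012)
  case 1
  then show ?case by (auto simp: segment_def)
next
  case (2 l)
  then obtain w1 w2 P' Q' where *: "segment w1 (Outer x j u) P'" "cross l P' Q'" "segment w2 Q' (Outer x' j' u')"
    by auto
  obtain p where P': "P' = Outer x j p" using *(1) by (auto simp: segment_def)
  have "\<exists>y u v q. Q' = Inner y u v q"
    using *(2) unfolding P' by (cases l) (auto dest: cross_outerD)
  with *(3) show ?case by (auto simp: segment_def)
next
  case (3 l l' ls)
  then obtain w1 w2 w3 P' Q' Q'' P'' where *: "segment w1 (Outer x j u) P'" "cross l P' Q'"
    "segment w2 Q' Q''" "cross l' Q'' P''" "route ls w3 P'' (Outer x' j' u')"
    by auto
  obtain p where P': "P' = Outer x j p" using *(1) by (auto simp: segment_def)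
  obtain a b q where Q': "Q' = Inner (g l x) a b q"
    using *(2) unfolding P' by (cases l) (auto dest: cross_outerD)
  then obtain q' where Q'': "Q'' = Inner (g l x) a b q'" using *(3) by (auto simp: segment_def)
  obtain z i r where P'': "P'' = Outer z i r" "z < n" "g l x = g l' z"
    using *(4) unfolding Q'' by (cases l') (auto dest: cross_innerD)
  show ?case using 3(1)[OF *(5)[unfolded P'']] P'' by auto
qed

text \<open>Both ends lie in the same outer copy, so the zigzag is closed, and each crossing weighs
  1, so it is short. By the girth two neighbouring labels agree; removing such pairs repeatedly
  leaves no crossing at all.\<close>

lemma route_collapse:
  assumes "route ls w (Outer x j u) (Outer x j' u')" "set ls \<subseteq> labels" "x < n" "w \<le> b1 * (b2 + 2)"
  shows "segment w (Outer x j u) (Outer x j' u')"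
  using assms(1,2)
proof (induction "length ls" arbitrary: ls rule: less_induct)
  case less
  show ?case
  proof (cases "ls = []")
    case True
    then show ?thesis using less.prems by simp
  next
    case False
    have "\<not> distinct_adj ls"
      using girth[OF False _ less.prems(2) \<open>x < n\<close> route_zigzag[OF less.prems(1)]]
        length_route[OF less.prems(1)] assms(4) by linarith
    then obtain ks l ms where ls: "ls = ks @ l # l # ms" by (rule not_distinct_adjE)
    then have "route (ks @ ms) w (Outer x j u) (Outer x j' u')"
      using less.prems route_remove_spur by auto
    then show ?thesis using less.hyps[of "ks @ ms"] less.prems(2) by (auto simp: ls)
  qed
qed

lemma arc_step:
  assumes "(P, Q) \<in> prod_arcs - prod_cut" "P' = P \<and> Q' = Q \<or> P' = Q \<and> Q' = P"
  shows "segment 1 P' Q' \<or> (\<exists>l\<in>labels. segment 0 P' P' \<and> cross l P' Q')"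
proof -
  have "(P, Q) \<in> prod_arcs" using assms(1) by simp
  then show ?thesis
  proof cases
    case (enter x u v j)
    then have "P = port False (u, v, j) x" "Q = iport False (u, v, j) x"
      by (auto simp: port_def iport_def)
    then have "cross (u, v, j) P' Q'" using assms(2) \<open>x < n\<close> unfolding cross_def by blast
    then show ?thesis using enter assms(2) by (intro disjI2 bexI[of _ "(u, v, j)"]) auto
  next
    case (leave x u v j)
    then have "Q = port True (u, v, j) x" "P = iport True (u, v, j) x"
      by (auto simp: port_def iport_def)
    then have "cross (u, v, j) P' Q'" using assms(2) \<open>x < n\<close> unfolding cross_def by blast
    then show ?thesis using leave assms(2) by (intro disjI2 bexI[of _ "(u, v, j)"]) auto
  next
    case (inner y u v p q)
    then have "(p, q) \<in> E2 - F2" using assms(1) prod_cut.intros(1) by blast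
    then have "(p, q) \<in> usym (E2 - F2) ^^ 1" "(q, p) \<in> usym (E2 - F2) ^^ 1"
      by (auto simp: usym_iff)
    then have "segment 1 P' Q'" using inner assms(2) unfolding segment_def by blast
    then show ?thesis ..
  next
    case (bypass x j u v)
    then show ?thesis using assms(1) prod_cut.intros(2) by blast
  qed
qed

lemma walk_route:
  assumes "(P, Outer x j u) \<in> usym (prod_arcs - prod_cut) ^^ m"
  shows "\<exists>ls. set ls \<subseteq> labels \<and> route ls m P (Outer x j u)"
  using assms
proof (induction m arbitrary: P)
  case 0
  then show ?case by (intro exI[of _ "[]"]) simp
next
  case (Suc m)
  obtain Q where Q: "(P, Q) \<in> usym (prod_arcs - prod_cut)" "(Q, Outer x j u) \<in> usym (prod_arcs - prod_cut) ^^ m"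
    using relpow_Suc_D2[OF Suc.prems] by blast
  obtain ls where ls: "set ls \<subseteq> labels" "route ls m Q (Outer x j u)"
    using Suc.IH[OF Q(2)] by blast
  consider "segment 1 P Q" | l where "l \<in> labels" "segment 0 P P" "cross l P Q"
    using Q(1) arc_step unfolding usym_iff by blast
  then show ?case
  proof cases
    case 1
    then have "route ls (1 + m) P (Outer x j u)" using ls(2) by (rule segment_route)
    then show ?thesis using ls(1) by auto
  next
    case 2
    have "0 + 1 + m \<le> Suc m" by simp
    then have "route (l # ls) (Suc m) P (Outer x j u)" using 2 ls(2) unfolding route.simps by blast
    then show ?thesis using ls(1) 2(1) by (intro exI[of _ "l # ls"]) auto
  qed
qed

text \<open>A walk shorter than the bound is within reach of the girth and collapses to a walk in
  the first gadget, with at least \<open>b1\<close> steps of weight \<open>b2 + 2\<close>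
  each.\<close>

lemma prod_distance:
  assumes s: "s \<in> prod_sources" and walk: "(s, prod_sink s) \<in> usym (prod_arcs - prod_cut) ^^ m"
  shows "b1 * (b2 + 2) \<le> m"
proof (rule ccontr)
  assume m: "\<not> b1 * (b2 + 2) \<le> m"
  obtain x j u where u: "s = Outer x j u" "x < n" "u \<in> S1" using s by (auto simp: prod_sources_def)
  have "(s, Outer x j (\<tau>1 u)) \<in> usym (prod_arcs - prod_cut) ^^ m" using walk by (simp add: u)
  from walk_route[OF this] obtain ls
    where "set ls \<subseteq> labels" "route ls m (Outer x j u) (Outer x j (\<tau>1 u))" by (auto simp: u)
  then have "segment m (Outer x j u) (Outer x j (\<tau>1 u))"
    using route_collapse u(2) m by simp
  then obtain k where "(u, \<tau>1 u) \<in> usym (E1 - F1) ^^ k" "k * (b2 + 2) \<le> m"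
    unfolding segment_def by auto
  moreover from this have "b1 * (b2 + 2) \<le> k * (b2 + 2)"
    using G1.distance[OF u(3)] by (intro mult_le_mono1) blast
  ultimately show False using m by linarith
qed

lemma gadget_arcs: "gadget prod_arcs prod_cut prod_sources prod_sink (a1 * (a2 + 2)) (b1 * (b2 + 2))"
proof
  show "finite prod_arcs" by (rule finite_prod_arcs)
  show "prod_cut \<subseteq> prod_arcs"
    using G1.cut_subset G2.cut_subset by (auto elim!: prod_cut.cases intro: prod_arcs.intros)
  show "finite prod_sources" by (simp add: prod_sources_def)
  show "v \<notin> prod_sources" if "(u, v) \<in> prod_arcs" for u v
    using that G1.no_arc_into_source G1.cut_subset by (auto elim!: prod_arcs.cases simp: prod_sources_def)
  show "val (prod_sink s) = val s" if flow: "xor_flow prod_arcs prod_sources val" and s: "s \<in> prod_sources" for val s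
  proof -
    obtain x j u where u: "s = Outer x j u" "x < n" "j \<in> S2" "u \<in> S1" using s by (auto simp: prod_sources_def)
    show ?thesis using G1.decode[OF outer_flow[OF flow u(2,3)] u(4)] by (simp add: u)
  qed
qed (use prod_levels prod_distance in auto)

end

subsection \<open>Iterated squaring\<close>

text \<open>The exponent \<open>r\<close> of \<open>sized_gadget\<close> after \<open>i\<close>
  squarings; the recursion is the one produced by \<open>sized_gadget_square\<close>.\<close>

primrec rate :: "nat \<Rightarrow> nat" where
  "rate 0 = 4"
| "rate (Suc i) = 4 * (rate i)\<^sup>2"

lemma rate_eq: "4 * rate i = 16 ^ 2 ^ i"
proof (induction i)
  case (Suc i)
  have "4 * rate (Suc i) = (4 * rate i)\<^sup>2" by (simp add: power2_eq_square)
  also have "\<dots> = 16 ^ 2 ^ Suc i" unfolding Suc by (simp add: power_mult[symmetric] mult.commute)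
  finally show ?case .
qed simp

lemma rate_ge: "4 \<le> rate i"
proof (induction i)
  case (Suc i)
  then have "1 * 1 \<le> rate i * rate i" by (intro mult_mono) auto
  then show ?case by (simp add: power2_eq_square)
qed simp

text \<open>\<open>N\<close> is the factor by which the sources outnumber the cut. The exponent
  \<open>r\<close> bounds the arcs per source, which decides how small the cut of the second factor
  must be in a product; \<open>e\<close> bounds the number of sources, hence the logarithm of the
  number of sessions.\<close>

definition sized_gadget :: "nat \<Rightarrow> nat \<Rightarrow> nat \<Rightarrow> nat \<Rightarrow> nat \<Rightarrow> bool" where
  "sized_gadget a b r e N \<longleftrightarrow> (\<exists>(E :: (vtx \<times> vtx) set) F S \<tau>. gadget E F S \<tau> a b \<and>
     N \<le> card S \<and> N * card F \<le> card S \<and> card E \<le> N ^ r * card S \<and> card S \<le> N ^ e)"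

lemma sized_gadget_base:
  assumes N: "2 \<le> N"
  shows "sized_gadget 3 4 4 1 N"
proof -
  have S: "card (Src ` {..<N}) = N" by (simp add: card_image inj_on_def)
  have "N * N + 3 * N + 1 \<le> N ^ 4 * N"
  proof -
    have "2 * 2 \<le> N * N" using N by (intro mult_mono) auto
    then have "4 * N \<le> N * N * N" "1 \<le> N" using N by (auto intro: mult_le_mono1)
    then have "N * N + 3 * N + 1 \<le> N * N + N * N * N" by linarith
    also have "\<dots> = N * N * (1 + N)" by (simp add: algebra_simps)
    also have "\<dots> \<le> N * N * (N * N * N)"
      using \<open>4 * N \<le> N * N * N\<close> \<open>1 \<le> N\<close> by (intro mult_le_mono2) linarith
    also have "\<dots> = N ^ 4 * N" by (simp add: eval_nat_numeral)
    finally show ?thesis .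
  qed
  then have "card (base_arcs N) \<le> N ^ 4 * N" using card_base_arcs[of N] by linarith
  then show ?thesis
    using gadget_base[of N] S unfolding sized_gadget_def by (intro exI conjI) auto
qed

text \<open>Per index \<open>x\<close> the product has \<open>card S1 * card S2\<close> sources and
  at most \<open>card E1 * card F2 + card F1 * card S2\<close> cut arcs. Ratio
  \<open>N\<^sup>2\<close> in the first factor handles the second summand. In the first summand
  \<open>card E1\<close> may exceed \<open>card S1\<close> by \<open>N ^ (2 * r)\<close>, which is
  why the second factor is taken with ratio \<open>N ^ (2 + 2 * r)\<close>. Each summand is then at
  most a \<open>2 * N\<close>-th part of the sources.\<close>

lemma sized_gadget_square:
  assumes N: "2 \<le> N" and r: "4 \<le> r" and e: "1 \<le> e" and b: "1 \<le> b"
    and G1: "sized_gadget a b r e (N\<^sup>2)" and G2: "sized_gadget a b r e (N ^ (2 + 2 * r))"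
  shows "sized_gadget (a * (a + 2)) (b * (b + 2)) (4 * r\<^sup>2) (94 * r * e * (b * (b + 2))) N"
proof -
  obtain E1 F1 :: "(vtx \<times> vtx) set" and S1 \<tau>1
    where g1: "gadget E1 F1 S1 \<tau>1 a b" and k1: "N\<^sup>2 \<le> card S1" "N\<^sup>2 * card F1 \<le> card S1"
      "card E1 \<le> (N\<^sup>2) ^ r * card S1" "card S1 \<le> (N\<^sup>2) ^ e"
    using G1 unfolding sized_gadget_def by blast
  obtain E2 F2 :: "(vtx \<times> vtx) set" and S2 \<tau>2
    where g2: "gadget E2 F2 S2 \<tau>2 a b" and k2: "N ^ (2 + 2 * r) \<le> card S2"
      "N ^ (2 + 2 * r) * card F2 \<le> card S2"
      "card E2 \<le> (N ^ (2 + 2 * r)) ^ r * card S2" "card S2 \<le> (N ^ (2 + 2 * r)) ^ e"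
    using G2 unfolding sized_gadget_def by blast
  define k where "k = card S1 * card S2"
  define L where "L = b * (b + 2)"
  define \<Lambda> where "\<Lambda> = {(u, v, j). (u, v) \<in> E1 - F1 \<and> j \<in> S2}"
  note fin = gadget.finite_arcs[OF g1] gadget.cut_subset[OF g1] gadget.finite_sources[OF g2]
  have \<Lambda>: "\<Lambda> = (\<lambda>((u, v), j). (u, v, j)) ` ((E1 - F1) \<times> S2)"
    unfolding \<Lambda>_def by force
  have "finite \<Lambda>" using fin unfolding \<Lambda> by auto
  have m1: "card (E1 - F1) \<le> card E1" "card F1 \<le> card E1"
    using fin by (auto intro: card_mono)
  have "card \<Lambda> \<le> card (E1 - F1) * card S2"
    unfolding \<Lambda> using fin by (intro card_image_bound) (auto simp: card_cartesian_product)
  also have "\<dots> \<le> (N\<^sup>2) ^ r * card S1 * card S2"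
    using m1(1) k1(3) by (intro mult_le_mono1) linarith
  also have "\<dots> \<le> (N\<^sup>2) ^ r * (N\<^sup>2) ^ e * (N ^ (2 + 2 * r)) ^ e"
    using k1(4) k2(4) by (intro mult_mono) auto
  also have "\<dots> = N ^ (2 * r + 2 * e + (2 + 2 * r) * e)"
    by (simp only: power_mult[symmetric] power_add[symmetric])
  also have "\<dots> \<le> N ^ (8 * r * e)"
  proof (rule power_increasing)
    have "r * 1 \<le> r * e" using e by (intro mult_le_mono2)
    moreover have "4 * e \<le> r * e" using r by (intro mult_le_mono1)
    moreover have "2 * r + 2 * e + (2 + 2 * r) * e = 2 * r + 4 * e + 2 * (r * e)"
      by (simp add: algebra_simps)
    ultimately show "2 * r + 2 * e + (2 + 2 * r) * e \<le> 8 * r * e"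
      unfolding mult.assoc[of 8] by linarith
  qed (use N in simp)
  finally have card_\<Lambda>: "card \<Lambda> \<le> N ^ (8 * r * e)" .

  obtain n and g :: "vtx \<times> vtx \<times> vtx \<Rightarrow> nat \<Rightarrow> nat"
    where n: "0 < n" "n \<le> ((8 * (card \<Lambda> + 1)\<^sup>2) ^ L + 1) ^ 4"
      and bij: "\<And>l. bij_betw (g l) {..<n} {..<n}"
      and girth: "\<And>ls x. ls \<noteq> [] \<Longrightarrow> length ls \<le> L \<Longrightarrow> set ls \<subseteq> \<Lambda> \<Longrightarrow> x < n \<Longrightarrow>
        zigzag g {..<n} ls x x \<Longrightarrow> \<not> distinct_adj ls"
    using ex_high_girth[OF \<open>finite \<Lambda>\<close>, of L] by blast
  interpret gadget_product E1 F1 S1 \<tau>1 a b E2 F2 S2 \<tau>2 a b n g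
    by (intro gadget_product.intro g1 g2 gadget_product_axioms.intro bij)
       (rule girth, auto simp: L_def \<Lambda>_def)

  have S: "card prod_sources = n * k"
    by (simp add: card_prod_sources k_def)
  have pos: "1 \<le> N ^ i" for i using N by simp
  have "N \<le> N\<^sup>2" using N by (simp add: power2_eq_square)
  then have "1 * (N * 1) \<le> n * (card S1 * card S2)"
    using n(1) k1(1) k2(1) pos[of "2 + 2 * r"] by (intro mult_mono) linarith+
  then have size_S: "N \<le> card prod_sources" by (simp add: S k_def)

  have "2 * N \<le> N\<^sup>2" using N by (simp add: power2_eq_square)
  have "2 * N * card F1 \<le> card S1"
    using mult_le_mono1[OF \<open>2 * N \<le> N\<^sup>2\<close>, of "card F1"] k1(2) by linarith
  then have 1: "2 * N * card F1 * card S2 \<le> k"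
    unfolding k_def by (rule mult_le_mono1)
  have "2 * N * (card (E1 - F1) * card F2) \<le> N\<^sup>2 * ((N\<^sup>2) ^ r * card S1 * card F2)"
    using \<open>2 * N \<le> N\<^sup>2\<close> m1(1) k1(3) by (intro mult_le_mono order_refl) linarith+
  also have "\<dots> = card S1 * (N ^ (2 + 2 * r) * card F2)"
    by (simp add: power_add power_mult power2_eq_square)
  also have "\<dots> \<le> k" unfolding k_def using k2(2) by (rule mult_le_mono2)
  finally have 2: "2 * N * (card (E1 - F1) * card F2) \<le> k" .
  have "N * (card (E1 - F1) * card F2 + card F1 * card S2) \<le> k"
    using 1 2 by (simp add: algebra_simps)
  then have "n * (N * (card (E1 - F1) * card F2 + card F1 * card S2)) \<le> n * k"
    by (rule mult_le_mono2)
  moreover have "N * card prod_cut \<le> N * (n * (card (E1 - F1) * card F2 + card F1 * card S2))"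
    using card_prod_cut by (rule mult_le_mono2)
  ultimately have size_F: "N * card prod_cut \<le> card prod_sources"
    unfolding S mult.left_commute[of n N] by (rule order_trans[rotated])

  have E1_S2: "card E1 * card S2 \<le> N ^ (2 * r) * k"
    using mult_le_mono1[OF k1(3), of "card S2"] by (simp add: k_def power_mult mult.assoc)
  have "card E1 * card E2 \<le> ((N\<^sup>2) ^ r * card S1) * ((N ^ (2 + 2 * r)) ^ r * card S2)"
    by (rule mult_le_mono[OF k1(3) k2(3)])
  also have "\<dots> = N ^ (2 * r) * N ^ ((2 + 2 * r) * r) * k"
    unfolding power_mult k_def by (simp only: mult_ac)
  finally have E1_E2: "card E1 * card E2 \<le> N ^ (2 * r) * N ^ ((2 + 2 * r) * r) * k" .
  have "2 * (card (E1 - F1) * card S2) + card (E1 - F1) * card E2 + card F1 * card S2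
      \<le> 2 * (card E1 * card S2) + card E1 * card E2 + card E1 * card S2"
    using m1 by (intro add_mono mult_le_mono order_refl)
  also have "\<dots> \<le> 3 * (N ^ (2 * r) * k) + N ^ (2 * r) * N ^ ((2 + 2 * r) * r) * k"
    using E1_S2 E1_E2 by linarith
  also have "\<dots> \<le> 4 * (N ^ (2 * r) * N ^ ((2 + 2 * r) * r) * k)"
    using mult_le_mono2[OF pos[of "(2 + 2 * r) * r"], of "N ^ (2 * r) * k"] by (simp add: mult_ac)
  also have "\<dots> \<le> N\<^sup>2 * (N ^ (2 * r) * N ^ ((2 + 2 * r) * r) * k)"
    using mult_mono[OF N N] by (intro mult_le_mono1) (simp add: power2_eq_square)
  also have "\<dots> = N ^ (2 + 2 * r + (2 + 2 * r) * r) * k"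
    by (simp only: power_add mult.assoc)
  also have "\<dots> \<le> N ^ (4 * r\<^sup>2) * k"
  proof (intro mult_le_mono1 power_increasing)
    have "4 * r \<le> r * r" using r by (rule mult_le_mono1)
    moreover have "2 + 2 * r + (2 + 2 * r) * r = 2 + 4 * r + 2 * (r * r)"
      by (simp add: algebra_simps)
    ultimately show "2 + 2 * r + (2 + 2 * r) * r \<le> 4 * r\<^sup>2"
      unfolding power2_eq_square using r by linarith
  qed (use N in simp)
  finally have "card prod_arcs \<le> n * (N ^ (4 * r\<^sup>2) * k)"
    using card_prod_arcs by (meson mult_le_mono2 order_trans)
  then have size_E: "card prod_arcs \<le> N ^ (4 * r\<^sup>2) * card prod_sources"
    by (simp add: S mult.left_commute)

  \<comment> \<open>Estimate of \<open>n\<close> as a power of \<open>N\<close>: the 5 in the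
    exponent absorbs the constant \<open>2 ^ 5\<close> in \<open>8 * (2 * N ^ d)\<^sup>2\<close>,
    and the added 1 absorbs the doubling caused by \<open>+ 1\<close> in the modulus.\<close>
  define d where "d = 8 * r * e"
  have L: "1 \<le> L" using b by (simp add: L_def)
  have re: "1 * 1 \<le> r * e" using r e by (intro mult_mono) auto
  have "card \<Lambda> + 1 \<le> 2 * N ^ d" using card_\<Lambda> pos[of d] by (simp add: d_def)
  then have "8 * (card \<Lambda> + 1)\<^sup>2 \<le> 8 * (2 * N ^ d)\<^sup>2"
    by (intro mult_le_mono2 power_mono) auto
  also have "\<dots> = 2 ^ 5 * (N ^ d)\<^sup>2" by (simp add: power_mult_distrib)
  also have "\<dots> \<le> N ^ 5 * (N ^ d)\<^sup>2" using N by (intro mult_le_mono1 power_mono) auto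
  also have "\<dots> = N ^ (5 + d * 2)" by (simp only: power_add power_mult)
  finally have "(8 * (card \<Lambda> + 1)\<^sup>2) ^ L \<le> N ^ ((5 + d * 2) * L)"
    unfolding power_mult by (rule power_mono) simp
  then have "(8 * (card \<Lambda> + 1)\<^sup>2) ^ L + 1 \<le> 2 * N ^ ((5 + d * 2) * L)"
    using pos[of "(5 + d * 2) * L"] by linarith
  also have "\<dots> \<le> N ^ ((5 + d * 2) * L + 1)"
    using N by simp
  finally have "((8 * (card \<Lambda> + 1)\<^sup>2) ^ L + 1) ^ 4 \<le> (N ^ ((5 + d * 2) * L + 1)) ^ 4"
    by (rule power_mono) simp
  then have n_le: "n \<le> N ^ (((5 + d * 2) * L + 1) * 4)"
    using n(2) unfolding power_mult by linarith
  have "card prod_sources \<le> N ^ (((5 + d * 2) * L + 1) * 4) * ((N\<^sup>2) ^ e * (N ^ (2 + 2 * r)) ^ e)"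
    unfolding S k_def using n_le k1(4) k2(4) by (intro mult_le_mono)
  also have "\<dots> = N ^ (((5 + d * 2) * L + 1) * 4 + (2 * e + (2 + 2 * r) * e))"
    by (simp only: power_mult[symmetric] power_add[symmetric])
  \<comment> \<open>In units of \<open>r * e * L\<close> the terms of the exponent contribute at
    most 20, 64, 4, 1 and 2, which stays below 94.\<close>
  also have "\<dots> \<le> N ^ (94 * r * e * L)"
  proof (rule power_increasing)
    have reL: "r * e * 1 \<le> r * e * L" using L by (intro mult_le_mono2)
    have "1 * L \<le> r * e * L" using re by (intro mult_le_mono1) simp
    moreover have "4 * e \<le> r * e" using r by (intro mult_le_mono1)
    moreover have "((5 + d * 2) * L + 1) * 4 + (2 * e + (2 + 2 * r) * e) =
        20 * L + 64 * (r * e * L) + 4 + 4 * e + 2 * (r * e)"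
      by (simp add: d_def algebra_simps)
    ultimately show "((5 + d * 2) * L + 1) * 4 + (2 * e + (2 + 2 * r) * e) \<le> 94 * r * e * L"
      unfolding mult.assoc[of 94] using reL L by linarith
  qed (use N in simp)
  finally have size_S': "card prod_sources \<le> N ^ (94 * r * e * L)" .
  show ?thesis
    unfolding sized_gadget_def
    using gadget_arcs size_S size_F size_E size_S' unfolding L_def by blast
qed

text \<open>Since \<open>y * (y + 2) + 1 = (y + 1)\<^sup>2\<close>, each product of a gadget family
  with itself squares \<open>a + 1\<close> and \<open>b + 1\<close>. The induction is over all
  \<open>N\<close> because the two factors are used with larger ratios.\<close>

lemma sized_gadget_iterate:
  assumes "2 \<le> N"
  shows "sized_gadget (4 ^ 2 ^ i - 1) (5 ^ 2 ^ i - 1) (rate i) (40000 ^ 2 ^ i) N"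
  using assms
proof (induction i arbitrary: N)
  case 0
  from sized_gadget_base[OF 0] obtain E F :: "(vtx \<times> vtx) set" and S \<tau>
    where *: "gadget E F S \<tau> 3 4" "N \<le> card S" "N * card F \<le> card S" "card E \<le> N ^ 4 * card S"
      "card S \<le> N ^ 1"
    unfolding sized_gadget_def by blast
  have "N ^ 1 \<le> N ^ 40000" by (rule power_increasing) (use 0 in auto)
  then have "card S \<le> N ^ 40000" using *(5) by linarith
  with *(1-4) have "sized_gadget 3 4 4 40000 N" unfolding sized_gadget_def by blast
  then show ?case by simp
next
  case (Suc i)
  define x :: nat where "x = 2 ^ i"
  have x: "1 \<le> x" by (simp add: x_def)
  have N1: "2 \<le> N\<^sup>2" using mult_mono[OF Suc.prems Suc.prems] by (simp add: power2_eq_square)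
  have "N ^ 1 \<le> N ^ (2 + 2 * rate i)" by (rule power_increasing) (use Suc.prems in auto)
  then have "N \<le> N ^ (2 + 2 * rate i)" unfolding power_one_right .
  then have N2: "2 \<le> N ^ (2 + 2 * rate i)" using Suc.prems by linarith
  have sq: "(c ^ x - 1) * (c ^ x - 1 + 2) = c ^ 2 ^ Suc i - 1" if c: "1 \<le> c" for c :: nat
  proof -
    obtain y where y: "c ^ x = Suc y" using one_le_power[OF c, of x] by (cases "c ^ x") auto
    have "c ^ 2 ^ Suc i = c ^ x * c ^ x" by (simp add: x_def power_add[symmetric] mult_2)
    then show ?thesis unfolding y by simp
  qed
  have "5 ^ 1 \<le> (5::nat) ^ x" by (rule power_increasing) (use x in auto)
  then have b: "1 \<le> 5 ^ x - (1::nat)" by simp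
  have "sized_gadget ((4 ^ x - 1) * (4 ^ x - 1 + 2)) ((5 ^ x - 1) * (5 ^ x - 1 + 2)) (4 * (rate i)\<^sup>2)
     (94 * rate i * 40000 ^ x * ((5 ^ x - 1) * (5 ^ x - 1 + 2))) N"
    using sized_gadget_square[OF Suc.prems rate_ge _ b Suc.IH[OF N1, folded x_def] Suc.IH[OF N2, folded x_def]]
    by simp
  then have *: "sized_gadget (4 ^ 2 ^ Suc i - 1) (5 ^ 2 ^ Suc i - 1) (rate (Suc i))
     (94 * rate i * 40000 ^ x * (5 ^ 2 ^ Suc i - 1)) N"
    by (simp only: sq one_le_numeral rate.simps)
  \<comment> \<open>The base 40000 is chosen above \<open>94 * 16 * 25 = 37600\<close>, so that the
    square of \<open>40000 ^ x\<close> absorbs the factors coming from 94, \<open>rate i\<close> and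
    the girth.\<close>
  have "94 * rate i * 40000 ^ x * (5 ^ 2 ^ Suc i - 1) \<le> 94 ^ x * 16 ^ x * 40000 ^ x * 25 ^ x"
  proof (intro mult_le_mono)
    show "94 \<le> (94::nat) ^ x" using power_increasing[OF x, of "94::nat"] by simp
    show "rate i \<le> 16 ^ x" using rate_eq[of i] by (simp add: x_def)
    have "(5::nat) ^ 2 ^ Suc i = (5\<^sup>2) ^ x" by (simp only: x_def power_mult[symmetric] power_Suc)
    then show "5 ^ 2 ^ Suc i - 1 \<le> (25::nat) ^ x" by simp
  qed simp
  also have "\<dots> = (94 * 16 * 40000 * 25) ^ x" by (simp only: power_mult_distrib)
  also have "\<dots> \<le> (40000\<^sup>2) ^ x" by (rule power_mono) simp_all
  also have "\<dots> = 40000 ^ 2 ^ Suc i" by (simp only: x_def power_mult[symmetric] power_Suc)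
  finally have "N ^ (94 * rate i * 40000 ^ x * (5 ^ 2 ^ Suc i - 1)) \<le> N ^ 40000 ^ 2 ^ Suc i"
    by (rule power_increasing) (use Suc.prems in simp)
  then show ?case
    using * unfolding sized_gadget_def by (blast intro: order_trans)
qed

subsection \<open>Protocols on instances with unit demands\<close>

lemma length_transcript [simp]: "length (transcript M P x r) = r"
  by (induction r) simp_all

lemma sent_eq: "sent M P x r u v = (if (u, v) \<in> links M
    then message P u v (own_packets M x u) (received (transcript M P x r) u) else [])"
  by (simp add: sent_def nth_append)

lemma transcript_eq: "transcript M P x r = map (sent M P x) [0..<r]"
proof (induction r)
  case (Suc r)
  have "transcript M P x (Suc r) = transcript M P x r @ [sent M P x r]"
    unfolding sent_def by (simp add: nth_append)
  then show ?case using Suc by simp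
qed simp

lemma received_eq: "received (transcript M P x r) v = map (\<lambda>i u. sent M P x i u v) [0..<r]"
  unfolding received_def transcript_eq by simp

lemma connected_pair_graph_iff:
  assumes "pair_graph G"
  shows "Digraph_Component.connected (with_proj G) \<longleftrightarrow>
    pverts G \<noteq> {} \<and> (\<forall>u\<in>pverts G. \<forall>v\<in>pverts G. (u, v) \<in> (parcs G)\<^sup>*)"
proof -
  interpret pair_graph G by fact
  have "u \<rightarrow>\<^sup>*\<^bsub>with_proj (mk_symmetric (with_proj G))\<^esub> v \<longleftrightarrow> (u, v) \<in> (parcs G)\<^sup>*"
    if "u \<in> pverts G" for u v
    using reachable_mk_symmetric_eq[OF pair_sym_arcs] reachable_conv'[OF that] by simp
  then show ?thesis
    by (auto simp: Digraph_Component.connected_def strongly_connected_def)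
qed

locale unit_instance =
  fixes M :: "'v unicast" and k :: nat
  assumes inst: "unicast_instance M"
    and k: "num_sessions M = k"
    and unit_demand: "i < k \<Longrightarrow> dem M i = 1"
    and source_neq_sink: "i < k \<Longrightarrow> src M i \<noteq> snk M i"
    and unit_capacity: "(u, v) \<in> links M \<Longrightarrow> capacity M {u, v} = 1"
begin

lemma k_pos: "1 \<le> k"
  using inst by (simp add: unicast_instance_def k)

lemma input_nth: "x \<in> inputs M q \<Longrightarrow> i < k \<Longrightarrow> x ! i = [x ! i ! 0] \<and> x ! i ! 0 < q"
proof -
  assume "x \<in> inputs M q" "i < k"
  then have "length (x ! i) = 1" "set (x ! i) \<subseteq> {..<q}"
    using unit_demand by (auto simp: inputs_def k subpacket_strings_def)
  then show ?thesis by (cases "x ! i") auto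
qed

lemma zero_input: "2 \<le> q \<Longrightarrow> replicate k [0] \<in> inputs M q"
  using unit_demand by (auto simp: inputs_def k subpacket_strings_def)

lemma one_input: "2 \<le> q \<Longrightarrow> i < k \<Longrightarrow> (replicate k [0])[i := [1]] \<in> inputs M q"
  using unit_demand by (auto simp: inputs_def k subpacket_strings_def nth_list_update)

lemma makespan_ge: "i < k \<Longrightarrow> T i \<le> makespan M T"
  unfolding makespan_def k by (intro Max_ge) auto

lemma makespan_const: "makespan M (\<lambda>_. T) = T"
proof -
  have "{..<num_sessions M} \<noteq> {}" using k_pos by (auto simp: k lessThan_empty_iff)
  then have "(\<lambda>_. T) ` {..<num_sessions M} = {T}" by (simp add: image_constant_conv)
  then show ?thesis by (simp add: makespan_def)
qed

text \<open>The all-zero input and the one that differs in packet \<open>i\<close> alone look the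
  same at the sink: the received messages agree by assumption, and the sink does not own packet
  \<open>i\<close> since it is not the source.\<close>

lemma not_determines:
  assumes "2 \<le> alphabet_size P" "i < k"
    and "\<And>r u. r < T \<Longrightarrow> sent M P (replicate k [0]) r u (snk M i) =
      sent M P ((replicate k [0])[i := [1]]) r u (snk M i)"
  shows "\<not> determines_packet M P i T"
proof
  define x where "x = replicate k [0::nat]"
  define y where "y = x[i := [1]]"
  assume "determines_packet M P i T"
  then obtain decode where decode: "\<And>z. z \<in> inputs M (alphabet_size P) \<Longrightarrow>
      decode (own_packets M z (snk M i)) (received (transcript M P z T) (snk M i)) = z ! i"
    unfolding determines_packet_def by blast
  have "own_packets M x (snk M i) = own_packets M y (snk M i)"
  proof
    fix j
    show "own_packets M x (snk M i) j = own_packets M y (snk M i) j"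
      using source_neq_sink[OF assms(2)] by (cases "j = i") (simp_all add: own_packets_def y_def)
  qed
  moreover have "received (transcript M P x T) (snk M i) = received (transcript M P y T) (snk M i)"
    unfolding received_eq x_def y_def using assms(3) by (intro map_cong ext refl) simp
  ultimately have "x ! i = y ! i"
    using decode[of x] decode[of y] zero_input one_input assms(1,2) by (simp add: x_def y_def)
  then show False using assms(2) by (simp add: x_def y_def)
qed

text \<open>Before the first round a sink has received nothing. This keeps the denominator of the
  coding gap positive.\<close>

lemma coding_makespan_pos:
  assumes "coding_protocol M P" "has_completion_times M P T"
  shows "1 \<le> makespan M T"
proof (rule ccontr)
  assume "\<not> 1 \<le> makespan M T"
  moreover have "0 < k" using k_pos by simp
  ultimately have "T 0 = 0" using makespan_ge[of 0 T] by simp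
  then have "determines_packet M P 0 0"
    using assms(2) \<open>0 < k\<close> unfolding has_completion_times_def k by metis
  then show False
    using not_determines[of P 0 0] assms(1) \<open>0 < k\<close> by (simp add: coding_protocol_def)
qed

lemma available_tokens:
  assumes slot: "\<And>r u v. (u, v) \<in> links M \<Longrightarrow> set (slot r u v) \<subseteq> available M slot r u"
    and "tok \<in> available M slot r u"
  shows "fst tok < k \<and> snd tok = 0"
  using assms(2)
proof (induction r arbitrary: u rule: less_induct)
  case (less r)
  then consider i j where "tok = (i, j)" "i < k" "j < dem M i"
    | r' w where "r' < r" "(w, u) \<in> links M" "tok \<in> set (slot r' w u)"
    unfolding available_def k by blast
  then show ?case
  proof cases
    case 1
    then show ?thesis using unit_demand[of i] by simp
  next
    case 2
    then show ?thesis using less.IH slot by blast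
  qed
qed

text \<open>If routing finished in fewer than \<open>b\<close> rounds, every token would have to use
  an arc of \<open>C\<close>, since without \<open>C\<close> it is too far from its sink. But
  \<open>C\<close> carries at most \<open>b * card C\<close> tokens in \<open>b\<close>
  rounds.\<close>

lemma routing_makespan_ge:
  assumes P: "routing_protocol M P" and T: "has_completion_times M P T"
    and C: "C \<subseteq> links M" "finite C" "b * card C < k"
    and \<phi>: "\<And>i. i < k \<Longrightarrow> \<phi> i (src M i) = 0" "\<And>i. i < k \<Longrightarrow> b \<le> \<phi> i (snk M i)"
      "\<And>i u v. i < k \<Longrightarrow> (u, v) \<in> links M - C \<Longrightarrow> \<phi> i v \<le> \<phi> i u + (1::nat)"
  shows "b \<le> makespan M T"
proof (rule ccontr)
  assume less: "\<not> b \<le> makespan M T"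
  define q where "q = alphabet_size P"
  have q: "2 \<le> q" and coding: "coding_protocol M P"
    using P by (auto simp: routing_protocol_def coding_protocol_def q_def)
  obtain slot where *: "\<forall>r. \<forall>(u, v)\<in>links M. set (slot r u v) \<subseteq> available M slot r u \<and>
      (\<forall>x\<in>inputs M q. sent M P x r u v = map (\<lambda>(i, j). x ! i ! j) (slot r u v))"
    using P unfolding routing_protocol_def q_def by blast
  have slot: "set (slot r u v) \<subseteq> available M slot r u" if "(u, v) \<in> links M" for r u v
    using * that by blast
  have sent: "sent M P x r u v = map (\<lambda>(i, j). x ! i ! j) (slot r u v)"
    if "(u, v) \<in> links M" "x \<in> inputs M q" for r u v x
    using * that by blast
  have short: "length (slot r u v) \<le> 1" if uv: "(u, v) \<in> links M" for r u v
  proof -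
    have "\<exists>l\<le>capacity M {u, v}. \<forall>x\<in>inputs M q. sent M P x r u v \<in> subpacket_strings q l"
      using coding uv unfolding coding_protocol_def q_def by blast
    then obtain l where "l \<le> 1" "sent M P (replicate k [0]) r u v \<in> subpacket_strings q l"
      using unit_capacity[OF uv] zero_input[OF q] by auto
    then show ?thesis
      unfolding sent[OF uv zero_input[OF q]] by (simp add: subpacket_strings_def)
  qed
  have crossed: "\<exists>r<b. \<exists>(u, v)\<in>C. (i, 0) \<in> set (slot r u v)" if i: "i < k" for i
  proof (rule ccontr)
    assume none: "\<not> (\<exists>r<b. \<exists>(u, v)\<in>C. (i, 0) \<in> set (slot r u v))"
    \<comment> \<open>A token that avoids \<open>C\<close> gains at most 1 in potential per round,
      so at time \<open>r\<close> it is held only by vertices of potential at most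
      \<open>r\<close>.\<close>
    have reach: "\<phi> i v \<le> r" if "r \<le> b" "(i, 0) \<in> available M slot r v" for r v
      using that
    proof (induction r arbitrary: v rule: less_induct)
      case (less r)
      then consider "src M i = v" | r' w where "r' < r" "(w, v) \<in> links M" "(i, 0) \<in> set (slot r' w v)"
        unfolding available_def by blast
      then show ?case
      proof cases
        case 1
        then show ?thesis using \<phi>(1)[OF i] by simp
      next
        case 2
        then have "\<phi> i w \<le> r'"
          using less.IH[of r' w] less.prems(1) slot[OF 2(2), of r'] by auto
        moreover have "r' < b" using 2(1) less.prems(1) by simp
        then have "(w, v) \<notin> C" using none 2(3) by blast
        then have "\<phi> i v \<le> \<phi> i w + 1" using \<phi>(3)[OF i] 2(2) by blast
        ultimately show ?thesis using 2(1) by simp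
      qed
    qed
    have Ti: "T i < b" using makespan_ge[OF i, of T] less by linarith
    have same: "sent M P (replicate k [0]) r u (snk M i) =
        sent M P ((replicate k [0])[i := [1]]) r u (snk M i)" if r: "r < T i" for r u
    proof (cases "(u, snk M i) \<in> links M")
      case True
      have "(i, 0) \<notin> set (slot r u (snk M i))"
      proof
        assume "(i, 0) \<in> set (slot r u (snk M i))"
        then have "(i, 0) \<in> available M slot (T i) (snk M i)"
          using True r unfolding available_def by blast
        then show False using reach[of "T i"] \<phi>(2)[OF i] Ti by fastforce
      qed
      then have "snd tok = 0 \<and> i \<noteq> fst tok" if "tok \<in> set (slot r u (snk M i))" for tok
        using available_tokens[OF slot, of tok r u] slot[OF True] that by (cases tok) auto
      then show ?thesis
        unfolding sent[OF True zero_input[OF q]] sent[OF True one_input[OF q i]]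
        by (intro map_cong refl) (simp add: case_prod_beta nth_list_update_neq)
    qed (simp add: sent_eq)
    have "\<not> determines_packet M P i (T i)"
      using not_determines[OF _ i same] q by (simp add: q_def)
    then show False using T i by (simp add: has_completion_times_def k)
  qed
  \<comment> \<open>Pigeonhole: by unit capacity each arc of \<open>C\<close> carries at most one
    token in each of the \<open>b\<close> rounds.\<close>
  have "{..<k} \<subseteq> (\<Union>r\<in>{..<b}. \<Union>(u, v)\<in>C. fst ` set (slot r u v))"
    using crossed by force
  then have "card {..<k} \<le> card (\<Union>r\<in>{..<b}. \<Union>(u, v)\<in>C. fst ` set (slot r u v))"
    using C(2) by (intro card_mono) auto
  also have "\<dots> \<le> (\<Sum>r<b. card (\<Union>(u, v)\<in>C. fst ` set (slot r u v)))"
    by (rule card_UN_le) simp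
  also have "\<dots> \<le> (\<Sum>r<b. \<Sum>(u, v)\<in>C. card (fst ` set (slot r u v)))"
    using C(2) by (intro sum_mono) (auto simp: case_prod_beta intro!: card_UN_le)
  also have "\<dots> \<le> (\<Sum>r<b. \<Sum>(u, v)\<in>C. 1)"
  proof (intro sum_mono, clarify)
    fix r u v assume "(u, v) \<in> C"
    then have "length (slot r u v) \<le> 1" using short C(1) by blast
    then show "card (fst ` set (slot r u v)) \<le> 1"
      by (meson card_image_le card_length finite_set order_trans)
  qed
  also have "\<dots> = b * card C" by (simp add: case_prod_beta)
  finally show False using C(3) by simp
qed

end

subsection \<open>The linear code\<close>

text \<open>The bit that \<open>u\<close> sends in round \<open>r\<close>: sources repeat their bit
  for ever, and all other vertices start with 0 and forward the parity of the previous
  round.\<close>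

primrec flow :: "('v \<times> 'v) set \<Rightarrow> 'v set \<Rightarrow> ('v \<Rightarrow> bool) \<Rightarrow> nat \<Rightarrow> 'v \<Rightarrow> bool" where
  "flow A S f 0 u \<longleftrightarrow> u \<in> S \<and> f u"
| "flow A S f (Suc r) u \<longleftrightarrow> (if u \<in> S then f u else odd (card {w. (w, u) \<in> A \<and> flow A S f r w}))"

text \<open>In-neighbours have smaller level, so the bit of \<open>u\<close> no longer changes from
  round \<open>lev u\<close> on.\<close>

lemma flow_stable:
  assumes lev: "\<And>u v. (u, v) \<in> A \<Longrightarrow> lev u < (lev v :: nat)"
  shows "lev u \<le> r \<Longrightarrow> lev u \<le> s \<Longrightarrow> flow A S f r u = flow A S f s u"
proof (induction "lev u" arbitrary: u r s rule: less_induct)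
  case less
  have *: "flow A S f t u = (if u \<in> S then f u else odd (card {w. (w, u) \<in> A \<and> flow A S f (lev w) w}))"
    if "lev u \<le> t" for t
  proof (cases t)
    case 0
    then have "{w. (w, u) \<in> A \<and> flow A S f (lev w) w} = {}" using that lev by fastforce
    then show ?thesis using 0 by (simp only: flow.simps card.empty) simp
  next
    case (Suc t')
    have "{w. (w, u) \<in> A \<and> flow A S f t' w} = {w. (w, u) \<in> A \<and> flow A S f (lev w) w}"
      using less.hyps[of _ t' "lev _"] lev that Suc by fastforce
    then show ?thesis using Suc by simp
  qed
  show ?case using *[OF less.prems(1)] *[OF less.prems(2)] by simp
qed

text \<open>The stable values solve the equations of \<open>xor_flow\<close>, and the sinks, being
  of level at most \<open>a\<close>, are stable at time \<open>a\<close>.\<close>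

lemma flow_decode:
  assumes G: "gadget A F S \<tau> a b" and s: "s \<in> S"
  shows "flow A S f a (\<tau> s) = f s"
proof -
  obtain lev :: "_ \<Rightarrow> nat" where lev: "\<And>u v. (u, v) \<in> A \<Longrightarrow> lev u < lev v" "\<And>s. s \<in> S \<Longrightarrow> lev (\<tau> s) \<le> a"
    using gadget.levels[OF G] by fast
  define val where "val u = flow A S f (lev u) u" for u
  have "xor_flow A S val"
    unfolding xor_flow_def
  proof (intro allI impI)
    fix v assume v: "v \<notin> S"
    have "val v = flow A S f (Suc (lev v)) v"
      unfolding val_def by (rule flow_stable[of A lev, OF lev(1)]) auto
    moreover have "{u. (u, v) \<in> A \<and> flow A S f (lev v) u} = {u. (u, v) \<in> A \<and> val u}"
      using flow_stable[of A lev, OF lev(1)] lev(1) unfolding val_def by (fastforce dest: less_imp_le)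
    ultimately show "val v = odd (card {u. (u, v) \<in> A \<and> val u})" using v by simp
  qed
  then have "val (\<tau> s) = val s" using gadget.decode[OF G _ s] by blast
  moreover have "val s = f s" using s by (cases "lev s") (auto simp: val_def)
  moreover have "flow A S f a (\<tau> s) = val (\<tau> s)"
    unfolding val_def by (rule flow_stable[of A lev, OF lev(1)]) (use lev(2)[OF s] in auto)
  ultimately show ?thesis by simp
qed

context unit_instance
begin

text \<open>A vertex owning a packet is a source; for injective \<open>src M\<close> the choice by
  \<open>SOME\<close> is unambiguous. Other vertices look only at the messages of the last
  round.\<close>

definition relay_bit :: "('v \<times> 'v) set \<Rightarrow> 'v \<Rightarrow> (nat \<rightharpoonup> nat list) \<Rightarrow> 'v history \<Rightarrow> nat" where
  "relay_bit A u own hist = (if dom own \<noteq> {} then hd (the (own (SOME i. i \<in> dom own)))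
     else if hist \<noteq> [] \<and> odd (card {w. (w, u) \<in> A \<and> last hist w = [1]}) then 1 else 0)"

definition xor_protocol :: "('v \<times> 'v) set \<Rightarrow> 'v protocol" where
  "xor_protocol A = \<lparr>alphabet_size = 2,
     message = (\<lambda>u v own hist. if (u, v) \<in> A then [relay_bit A u own hist] else [])\<rparr>"

definition input_bit :: "nat list list \<Rightarrow> 'v \<Rightarrow> bool" where
  "input_bit x u \<longleftrightarrow> (\<exists>i<k. src M i = u \<and> x ! i = [1])"

lemma relay_bit_flow:
  assumes A: "A \<subseteq> links M" and inj: "inj_on (src M) {..<k}" and x: "x \<in> inputs M 2"
  shows "relay_bit A u (own_packets M x u) (received (transcript M (xor_protocol A) x r) u) =
      of_bool (flow A (src M ` {..<k}) (input_bit x) r u)"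
    and "(u, v) \<in> A \<Longrightarrow>
      sent M (xor_protocol A) x r u v = [of_bool (flow A (src M ` {..<k}) (input_bit x) r u)]"
proof -
  let ?f = "flow A (src M ` {..<k}) (input_bit x)"
  have src: "relay_bit A u (own_packets M x u) hist = of_bool (input_bit x u)"
    if u: "u \<in> src M ` {..<k}" for u hist
  proof -
    obtain i where i: "i < k" "src M i = u" using u by auto
    have uniq: "i' = i" if "i' < k" "src M i' = u" for i'
      using inj that i unfolding inj_on_def by auto
    have "own_packets M x u j = (if j = i then Some (x ! i) else None)" for j
    proof (cases "j = i")
      case True
      then show ?thesis using i by (simp add: own_packets_def k)
    next
      case False
      then have "\<not> (j < num_sessions M \<and> src M j = u)" using uniq unfolding k by blast
      then show ?thesis using False unfolding own_packets_def by simp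
    qed
    then have dom: "dom (own_packets M x u) = {i}"
      by (auto simp: dom_def)
    have "relay_bit A u (own_packets M x u) hist = hd (the (own_packets M x u i))"
      unfolding relay_bit_def dom by simp
    then have "relay_bit A u (own_packets M x u) hist = hd (x ! i)"
      using i by (simp add: own_packets_def k)
    moreover have "input_bit x u \<longleftrightarrow> x ! i = [1]"
      using i uniq unfolding input_bit_def by blast
    moreover obtain c where "x ! i = [c]" "c < 2"
      using input_nth[OF x i(1)] by metis
    ultimately show ?thesis by (cases "c = 0") (auto simp: less_2_cases_iff)
  qed
  have non_src: "dom (own_packets M x u) = {}" if "u \<notin> src M ` {..<k}" for u
    using that by (auto simp: own_packets_def dom_def k)
  have sent: "sent M (xor_protocol A) x r u v =
      [relay_bit A u (own_packets M x u) (received (transcript M (xor_protocol A) x r) u)]"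
    if "(u, v) \<in> A" for r u v
    using that A by (auto simp: sent_eq xor_protocol_def)
  have bit: "relay_bit A u (own_packets M x u) (received (transcript M (xor_protocol A) x r) u) =
      of_bool (?f r u)" for r u
  proof (induction r arbitrary: u)
    case 0
    show ?case
    proof (cases "u \<in> src M ` {..<k}")
      case False
      then show ?thesis using non_src[OF False] by (simp add: relay_bit_def received_def)
    qed (simp add: src)
  next
    case (Suc r)
    show ?case
    proof (cases "u \<in> src M ` {..<k}")
      case False
      have "{w. (w, u) \<in> A \<and> sent M (xor_protocol A) x r w u = [1]} = {w. (w, u) \<in> A \<and> ?f r w}"
        by (intro Collect_cong conj_cong refl) (simp add: sent Suc.IH)
      then show ?thesis
        using False non_src[OF False] unfolding relay_bit_def received_eq by simp
    qed (simp add: src)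
  qed
  show "relay_bit A u (own_packets M x u) (received (transcript M (xor_protocol A) x r) u) =
      of_bool (?f r u)"
    by (rule bit)
  show "sent M (xor_protocol A) x r u v = [of_bool (?f r u)]" if "(u, v) \<in> A"
    unfolding sent[OF that] bit ..
qed

lemma ex_coding_protocol:
  assumes A: "A \<subseteq> links M" and inj: "inj_on (src M) {..<k}"
    and G: "gadget A F (src M ` {..<k}) \<tau> a b" and \<tau>: "\<And>i. i < k \<Longrightarrow> \<tau> (src M i) = snk M i"
  shows "\<exists>P. coding_protocol M P \<and> has_completion_times M P (\<lambda>_. a)"
proof (intro exI conjI)
  show "coding_protocol M (xor_protocol A)"
    unfolding coding_protocol_def
  proof (intro conjI allI, simp add: xor_protocol_def, clarify)
    fix r u v assume uv: "(u, v) \<in> links M"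
    have "alphabet_size (xor_protocol A) = 2" by (simp add: xor_protocol_def)
    moreover have "sent M (xor_protocol A) x r u v \<in> subpacket_strings 2 (if (u, v) \<in> A then 1 else 0)"
      if "x \<in> inputs M 2" for x
      using relay_bit_flow(2)[OF A inj that, of u v r] uv
      by (auto simp: subpacket_strings_def sent_eq xor_protocol_def)
    ultimately show "\<exists>l\<le>capacity M {u, v}. \<forall>x\<in>inputs M (alphabet_size (xor_protocol A)).
        sent M (xor_protocol A) x r u v \<in> subpacket_strings (alphabet_size (xor_protocol A)) l"
      using unit_capacity[OF uv] by (intro exI[of _ "if (u, v) \<in> A then 1 else 0"]) auto
  qed
  show "has_completion_times M (xor_protocol A) (\<lambda>_. a)"
    unfolding has_completion_times_def determines_packet_def
  proof (intro allI impI exI ballI)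
    fix i x assume i: "i < num_sessions M" and x: "x \<in> inputs M (alphabet_size (xor_protocol A))"
    have x2: "x \<in> inputs M 2" using x by (simp add: xor_protocol_def)
    have ik: "i < k" using i by (simp add: k)
    have "relay_bit A (snk M i) (own_packets M x (snk M i))
        (received (transcript M (xor_protocol A) x a) (snk M i)) = of_bool (input_bit x (src M i))"
      using relay_bit_flow(1)[OF A inj x2] flow_decode[OF G, of "src M i"] \<tau>[OF ik] ik by simp
    moreover have "input_bit x (src M i) \<longleftrightarrow> x ! i = [1]"
      using inj ik unfolding input_bit_def inj_on_def by auto
    moreover obtain c where "x ! i = [c]" "c < 2"
      using input_nth[OF x2 ik] by metis
    ultimately show "(\<lambda>own hist. [relay_bit A (snk M i) own hist]) (own_packets M x (snk M i))
        (received (transcript M (xor_protocol A) x a) (snk M i)) = x ! i"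
      by (cases "c = 0") (auto simp: less_2_cases_iff)
  qed
qed

end

subsection \<open>Flooding\<close>

context unit_instance
begin

text \<open>Flooding shows that some routing protocol terminates. Round \<open>r\<close> is reserved
  for the token of session \<open>r mod k\<close>, so unit capacities suffice, and
  \<open>known r u\<close> lists the tokens held by \<open>u\<close> before round
  \<open>r\<close>.\<close>

primrec known :: "nat \<Rightarrow> 'v \<Rightarrow> nat set" where
  "known 0 u = {i. i < k \<and> src M i = u}"
| "known (Suc r) u = known r u \<union> {i. i = r mod k \<and> (\<exists>w. (w, u) \<in> links M \<and> i \<in> known r w)}"

definition flood_slot :: "nat \<Rightarrow> 'v \<Rightarrow> 'v \<Rightarrow> (nat \<times> nat) list" where
  "flood_slot r u v = (if r mod k \<in> known r u then [(r mod k, 0)] else [])"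

text \<open>The pair \<open>p\<close> is a round and a neighbour from which the token arrived. As
  \<open>known\<close> does not depend on the input, the vertex can locate the token in its
  history.\<close>

definition token_value :: "'v \<Rightarrow> (nat \<rightharpoonup> nat list) \<Rightarrow> 'v history \<Rightarrow> nat \<Rightarrow> nat" where
  "token_value u own hist i = (case own i of Some p \<Rightarrow> hd p
     | None \<Rightarrow> (let p = SOME p. fst p < length hist \<and> fst p mod k = i \<and> (snd p, u) \<in> links M \<and>
          i \<in> known (fst p) (snd p) in hd ((hist ! fst p) (snd p))))"

definition flood :: "'v protocol" where
  "flood = \<lparr>alphabet_size = 2, message = (\<lambda>u v own hist.
     if length hist mod k \<in> known (length hist) u
     then [token_value u own hist (length hist mod k)] else [])\<rparr>"

lemma known_cases:
  "i \<in> known r u \<Longrightarrow> (i < k \<and> src M i = u) \<or>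
     (\<exists>r'<r. \<exists>w. r' mod k = i \<and> (w, u) \<in> links M \<and> i \<in> known r' w)"
proof (induction r)
  case (Suc r)
  then show ?case using less_Suc_eq by auto
qed simp

lemma known_less: "i \<in> known r u \<Longrightarrow> i < k"
  using k_pos by (induction r arbitrary: u) auto

lemma known_available: "i \<in> known r u \<Longrightarrow> (i, 0) \<in> available M flood_slot r u"
  using known_cases[of i r u] unit_demand unfolding available_def
  by (force simp: flood_slot_def k)

lemma token_value_correct:
  assumes x: "x \<in> inputs M 2" and i: "i \<in> known r u"
  shows "token_value u (own_packets M x u) (received (transcript M flood x r) u) i = x ! i ! 0"
  using i
proof (induction r arbitrary: u i rule: less_induct)
  case (less r)
  have ik: "i < k" using less.prems by (rule known_less)
  show ?case
  proof (cases "src M i = u")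
    case True
    have "hd (x ! i) = x ! i ! 0" using input_nth[OF x ik] by (metis list.sel(1))
    then show ?thesis using True ik by (simp add: token_value_def own_packets_def k)
  next
    case False
    define hist where "hist = received (transcript M flood x r) u"
    have len: "length hist = r" by (simp add: hist_def received_def)
    let ?P = "\<lambda>p. fst p < length hist \<and> fst p mod k = i \<and> (snd p, u) \<in> links M \<and> i \<in> known (fst p) (snd p)"
    define p where "p = (SOME p. ?P p)"
    obtain r' w where "r' < r" "r' mod k = i" "(w, u) \<in> links M" "i \<in> known r' w"
      using known_cases[OF less.prems] False by blast
    then have "?P (r', w)" by (simp add: len)
    then have p: "?P p" unfolding p_def by (rule someI)
    have "own_packets M x u i = None" using False by (simp add: own_packets_def)
    then have "token_value u (own_packets M x u) hist i = hd ((hist ! fst p) (snd p))"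
      unfolding token_value_def Let_def p_def by simp
    also have "(hist ! fst p) (snd p) = sent M flood x (fst p) (snd p) u"
      using p len unfolding hist_def received_eq by simp
    also have "\<dots> = [x ! i ! 0]"
      using p less.IH[of "fst p" i "snd p"] len by (simp add: sent_eq flood_def received_def)
    finally show ?thesis by (simp add: hist_def)
  qed
qed

lemma sent_flood:
  assumes "x \<in> inputs M 2" "(u, v) \<in> links M"
  shows "sent M flood x r u v = map (\<lambda>(i, j). x ! i ! j) (flood_slot r u v)"
proof -
  have "length (received (transcript M flood x r) u) = r" by (simp add: received_def)
  moreover have "message flood u v own hist = (if length hist mod k \<in> known (length hist) u
     then [token_value u own hist (length hist mod k)] else [])" for own hist
    by (simp add: flood_def)
  ultimately show ?thesis
    using token_value_correct[OF assms(1)] assms(2) unfolding sent_eq flood_slot_def by simp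
qed

lemma routing_flood: "routing_protocol M flood"
proof -
  have q: "alphabet_size flood = 2" by (simp add: flood_def)
  have "coding_protocol M flood"
    unfolding coding_protocol_def q
  proof (intro conjI allI ballI, simp, clarify)
    fix r u v assume uv: "(u, v) \<in> links M"
    have "sent M flood x r u v \<in> subpacket_strings 2 (length (flood_slot r u v))"
      if "x \<in> inputs M 2" for x
      using input_nth[OF that] known_less[of "r mod k" r u]
      by (auto simp: sent_flood[OF that uv] subpacket_strings_def flood_slot_def)
    moreover have "length (flood_slot r u v) \<le> capacity M {u, v}"
      by (simp add: unit_capacity[OF uv] flood_slot_def)
    ultimately show "\<exists>l\<le>capacity M {u, v}. \<forall>x\<in>inputs M 2. sent M flood x r u v \<in> subpacket_strings 2 l"
      by blast
  qed
  moreover have "set (flood_slot r u v) \<subseteq> available M flood_slot r u" for r u v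
    using known_available[of "r mod k" r u] by (auto simp: flood_slot_def)
  ultimately show ?thesis
    using sent_flood unfolding routing_protocol_def q by (intro conjI exI[of _ flood_slot]) auto
qed

lemma known_mono: "r \<le> r' \<Longrightarrow> known r u \<subseteq> known r' u"
  by (rule lift_Suc_mono_le[of "\<lambda>r. known r u"]) auto

text \<open>Among \<open>k\<close> consecutive rounds one is reserved for session
  \<open>i\<close>.\<close>

lemma known_step:
  assumes "i \<in> known r u" "(u, v) \<in> links M"
  shows "i \<in> known (r + k) v"
proof -
  have i: "i < k" using assms(1) by (rule known_less)
  obtain r' where r': "r \<le> r'" "r' < r + k" "r' mod k = i"
  proof (cases "r mod k \<le> i")
    case True
    have "r = r div k * k + r mod k" by simp
    then have "r \<le> r div k * k + i" "r div k * k + i < r + k" using True i by linarith+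
    then show ?thesis using i that[of "r div k * k + i"] by simp
  next
    case False
    have "r = r div k * k + r mod k" "r mod k < k" using i by simp_all
    then have "r \<le> Suc (r div k) * k + i" "Suc (r div k) * k + i < r + k"
      using False unfolding mult_Suc by linarith+
    moreover have "(Suc (r div k) * k + i) mod k = i"
      using i by (simp only: mod_mult_self3 mod_less)
    ultimately show ?thesis by (rule that)
  qed
  have "i \<in> known r' u" using known_mono[OF r'(1)] assms(1) by blast
  then have "i \<in> known (Suc r') v" using r'(3) assms(2) by auto
  then show ?thesis using known_mono[of "Suc r'" "r + k"] r'(2) by auto
qed

lemma ex_routing_protocol: "\<exists>T. has_completion_times M flood T"
proof -
  have "\<exists>r. i \<in> known r (snk M i)" if i: "i < k" for i
  proof -
    have "pair_graph (network M)" "Digraph_Component.connected (with_proj (network M))"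
      "src M i \<in> pverts (network M)" "snk M i \<in> pverts (network M)"
      using inst i by (auto simp: unicast_instance_def k)
    then have "(src M i, snk M i) \<in> (links M)\<^sup>*"
      using connected_pair_graph_iff by blast
    then show ?thesis
    proof (induction rule: rtrancl_induct)
      case base
      show ?case using i by (intro exI[of _ 0]) simp
    next
      case (step v w)
      then show ?case using known_step by blast
    qed
  qed
  then obtain T where T: "\<And>i. i < k \<Longrightarrow> i \<in> known (T i) (snk M i)" by metis
  have "determines_packet M flood i (T i)" if i: "i < num_sessions M" for i
    unfolding determines_packet_def
  proof (intro exI[of _ "\<lambda>own hist. [token_value (snk M i) own hist i]"] ballI)
    fix x assume "x \<in> inputs M (alphabet_size flood)"
    then have x: "x \<in> inputs M 2" by (simp add: flood_def)
    have ik: "i < k" using i by (simp add: k)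
    show "[token_value (snk M i) (own_packets M x (snk M i)) (received (transcript M flood x (T i)) (snk M i)) i] = x ! i"
      using token_value_correct[OF x T[OF ik]] input_nth[OF x ik] by simp
  qed
  then show ?thesis unfolding has_completion_times_def by blast
qed

lemma makespan_coding_gap_ge:
  assumes coding: "\<exists>P. coding_protocol M P \<and> has_completion_times M P (\<lambda>_. a)"
    and routing: "\<And>P T. routing_protocol M P \<Longrightarrow> has_completion_times M P T \<Longrightarrow> b \<le> makespan M T"
  shows "real b / real a \<le> makespan_coding_gap M"
proof -
  define C where "C = {makespan M T | P T. coding_protocol M P \<and> has_completion_times M P T}"
  define R where "R = {makespan M T | P T. routing_protocol M P \<and> has_completion_times M P T}"
  have "a \<in> C" using coding makespan_const[of a] unfolding C_def by force
  then have "Inf C \<le> a" by (simp add: cInf_lower)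
  have "Inf C \<in> C" using \<open>a \<in> C\<close> by (intro Inf_nat_def1) auto
  then have "1 \<le> Inf C" using coding_makespan_pos unfolding C_def by auto
  \<comment> \<open>An infimum of natural numbers is attained only for a nonempty set; flooding
    supplies an element.\<close>
  have "R \<noteq> {}" using ex_routing_protocol routing_flood unfolding R_def by blast
  then have "Inf R \<in> R" by (rule Inf_nat_def1)
  then have "b \<le> Inf R" using routing unfolding R_def by auto
  have "real b / real a \<le> real (Inf R) / real (Inf C)"
    using \<open>Inf C \<le> a\<close> \<open>1 \<le> Inf C\<close> \<open>b \<le> Inf R\<close> by (intro frac_le) auto
  then show ?thesis
    by (simp add: makespan_coding_gap_def routing_makespan_def coding_makespan_def C_def R_def)
qed

end

subsection \<open>From gadgets to instances\<close>

text \<open>Renaming of vertices for the coding part only: the cut is emptied and the distance bound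
  set to 0, which makes the distance condition trivial.\<close>

lemma (in gadget) gadget_image:
  assumes f: "\<And>u. h (f u) = u"
  shows "gadget (map_prod f f ` E) {} (f ` S) (\<lambda>p. f (\<tau> (h p))) a 0"
proof
  have inj: "inj f" using f by (metis injI)
  obtain lev :: "_ \<Rightarrow> nat" where "\<And>u v. (u, v) \<in> E \<Longrightarrow> lev u < lev v" "\<And>s. s \<in> S \<Longrightarrow> lev (\<tau> s) \<le> a"
    using levels by fast
  then show "\<exists>lev::_ \<Rightarrow> nat. (\<forall>(u, v)\<in>map_prod f f ` E. lev u < lev v) \<and> (\<forall>s\<in>f ` S. lev (f (\<tau> (h s))) \<le> a)"
    by (intro exI[of _ "\<lambda>p. lev (h p)"]) (auto simp: f)
  show "val (f (\<tau> (h p))) = val p" if flow: "xor_flow (map_prod f f ` E) (f ` S) val" and p: "p \<in> f ` S" for val p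
  proof -
    have "xor_flow E S (\<lambda>u. val (f u))"
      unfolding xor_flow_def
    proof (intro allI impI)
      fix v assume "v \<notin> S"
      then have "f v \<notin> f ` S" using inj by (auto dest: injD)
      moreover have "{p. (p, f v) \<in> map_prod f f ` E \<and> val p} = f ` {u. (u, v) \<in> E \<and> val (f u)}"
        using inj by (auto dest: injD)
      ultimately show "val (f v) = odd (card {u. (u, v) \<in> E \<and> val (f u)})"
        using flow card_image[OF inj_on_subset[OF inj subset_UNIV]] by (simp add: xor_flow_def)
    qed
    moreover obtain s where s: "p = f s" "s \<in> S" using p by auto
    ultimately show ?thesis using decode[of "\<lambda>u. val (f u)" s] by (simp add: f)
  qed
  show "finite (map_prod f f ` E)" "finite (f ` S)"
    using finite_arcs finite_sources by auto
  show "v \<notin> f ` S" if "(u, v) \<in> map_prod f f ` E" for u v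
    using that no_arc_into_source inj by (auto dest: injD)
qed auto

lemma ex_distance_potential:
  fixes b :: nat
  assumes "\<And>m. (s, t) \<in> R ^^ m \<Longrightarrow> b \<le> m"
  shows "\<exists>\<phi>. \<phi> s = 0 \<and> b \<le> \<phi> t \<and> (\<forall>(u, v)\<in>R. \<phi> v \<le> \<phi> u + (1::nat))"
proof -
  \<comment> \<open>The distance from \<open>s\<close> truncated at \<open>b\<close>; the
    alternative \<open>m = b\<close> also gives unreachable vertices a value.\<close>
  define \<phi> where "\<phi> v = (LEAST m. m = b \<or> (s, v) \<in> R ^^ m)" for v
  have least: "\<phi> v = b \<or> (s, v) \<in> R ^^ \<phi> v" for v
    unfolding \<phi>_def by (rule LeastI[of _ b]) simp
  have le: "\<phi> v \<le> m" if "m = b \<or> (s, v) \<in> R ^^ m" for v m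
    unfolding \<phi>_def using that by (rule Least_le)
  have "\<phi> s = 0" using le[of 0 s] by simp
  moreover have "b \<le> \<phi> t" using least[of t] assms by auto
  moreover have "\<forall>(u, v)\<in>R. \<phi> v \<le> \<phi> u + 1"
  proof clarify
    fix u v assume uv: "(u, v) \<in> R"
    from least[of u] show "\<phi> v \<le> \<phi> u + 1"
    proof
      assume "\<phi> u = b"
      moreover have "\<phi> v \<le> b" using le by simp
      ultimately show ?thesis by simp
    next
      assume "(s, u) \<in> R ^^ \<phi> u"
      then show ?thesis using uv by (intro le disjI2) auto
    qed
  qed
  ultimately show ?thesis by blast
qed

text \<open>
  The instance has to be connected. Above every vertex of the gadget a path of length \<open>b\<close> is
  erected, and the tips of these paths are joined to one of them, so that no short walk between
  vertices of the gadget is added.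
\<close>

lemma ex_unicast_instance:
  fixes E F :: "('v::countable \<times> 'v) set"
  assumes G: "gadget E F S \<tau> a b" and b: "1 \<le> b" and F: "2 * b * card F < card S"
  shows "\<exists>M :: nat unicast. unicast_instance M \<and> num_sessions M = card S \<and>
    real b / real a \<le> makespan_coding_gap M"
proof -
  interpret gadget E F S \<tau> a b by fact
  define V where "V = fst ` E \<union> snd ` E \<union> S \<union> \<tau> ` S"
  have "S \<noteq> {}" using F by auto
  then obtain v0 where v0: "v0 \<in> V" unfolding V_def by auto
  have finV: "finite V" using finite_arcs finite_sources by (simp add: V_def)
  \<comment> \<open>\<open>c v t\<close> is the vertex at height \<open>t\<close> of the path above
    \<open>v\<close>; height 0 is the gadget vertex itself.\<close>
  define c :: "'v \<Rightarrow> nat \<Rightarrow> nat" where "c v t = to_nat (v, t)" for v t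
  define h :: "nat \<Rightarrow> 'v \<times> nat" where "h = from_nat"
  have h [simp]: "h (c v t) = (v, t)" for v t by (simp add: h_def c_def)
  have c_eq [simp]: "c u t = c v t' \<longleftrightarrow> u = v \<and> t = t'" for u v t t' by (simp add: c_def)
  define f where "f v = c v 0" for v
  define A where "A = map_prod f f ` E"
  define L where "L = usym (A \<union> {(c v t, c v (Suc t)) | v t. v \<in> V \<and> t < b} \<union>
    {(c v b, c v0 b) | v. v \<in> V \<and> v \<noteq> v0})"
  define W where "W = (\<lambda>(v, t). c v t) ` (V \<times> {..b})"
  obtain xs where xs: "set xs = S" "distinct xs" using finite_distinct_list[OF finite_sources] by blast
  define M where "M = \<lparr>network = \<lparr>pverts = W, parcs = L\<rparr>, capacity = (\<lambda>_. 1),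
    sessions = map (\<lambda>s. \<lparr>source = f s, sink = f (\<tau> s), demand = 1\<rparr>) xs\<rparr>"
  have num: "num_sessions M = card S"
    using distinct_card[OF xs(2)] by (simp add: M_def num_sessions_def xs(1))
  have sess: "src M i = f (xs ! i)" "snk M i = f (\<tau> (xs ! i))" "dem M i = 1" "xs ! i \<in> S"
    if "i < card S" for i
    using that distinct_card[OF xs(2)] xs(1) by (auto simp: M_def)
  have links: "links M = L" by (simp add: M_def)
  have E_V: "u \<in> V" "v \<in> V" if "(u, v) \<in> E" for u v
    using that unfolding V_def by force+
  have cW: "c v t \<in> W \<longleftrightarrow> v \<in> V \<and> t \<le> b" for v t
    by (auto simp: W_def)
  have L_cases: thesis if "(p, q) \<in> L"
      "\<And>u v. p = c u 0 \<Longrightarrow> q = c v 0 \<Longrightarrow> (u, v) \<in> usym E \<Longrightarrow> thesis"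
      "\<And>v t. v \<in> V \<Longrightarrow> t < b \<Longrightarrow> p = c v t \<and> q = c v (Suc t) \<or> q = c v t \<and> p = c v (Suc t) \<Longrightarrow> thesis"
      "\<And>u v. u \<in> V \<Longrightarrow> v \<in> V \<Longrightarrow> u \<noteq> v \<Longrightarrow> p = c u b \<Longrightarrow> q = c v b \<Longrightarrow> thesis" for p q thesis
    using that(1) unfolding L_def usym_iff A_def
    by (elim disjE UnE) (use that(2-) v0 in \<open>auto simp: f_def usym_iff\<close>)
  have no_loop: "(v, v) \<notin> E" for v using arc_irrefl by blast
  have L_W: "p \<in> W \<and> q \<in> W \<and> p \<noteq> q" if "(p, q) \<in> L" for p q
    using that by (rule L_cases) (use E_V no_loop in \<open>auto simp: cW usym_iff\<close>)
  have "finite W" by (simp add: W_def finV)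
  moreover have "L \<subseteq> W \<times> W" using L_W by auto
  ultimately have "finite L" by (meson finite_SigmaI finite_subset)
  have sym: "sym L" unfolding L_def usym_def by (auto intro: symI)
  have graph: "pair_graph (network M)"
    using \<open>finite W\<close> \<open>finite L\<close> L_W sym
    by unfold_locales (auto simp: M_def symmetric_def)
  have up: "(c v t, c v b) \<in> L\<^sup>*" if "v \<in> V" "t \<le> b" for v t
    using that(2)
  proof (induction "b - t" arbitrary: t)
    case (Suc d)
    then have "(c v t, c v (Suc t)) \<in> L" using that(1) unfolding L_def usym_iff by auto
    moreover have "(c v (Suc t), c v b) \<in> L\<^sup>*" using Suc by simp
    ultimately show ?case by (rule converse_rtrancl_into_rtrancl)
  qed simp
  have top: "(c v b, c v0 b) \<in> L\<^sup>*" if "v \<in> V" for v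
    using that unfolding L_def usym_iff by (cases "v = v0") (auto simp: usym_iff)
  have to_top: "(p, c v0 b) \<in> L\<^sup>*" if p: "p \<in> W" for p
  proof -
    obtain v t where "p = c v t" "v \<in> V" "t \<le> b" using p by (auto simp: W_def)
    then show ?thesis using up top by (metis rtrancl_trans)
  qed
  have "(p, q) \<in> L\<^sup>*" if "p \<in> W" "q \<in> W" for p q
  proof -
    have "(c v0 b, q) \<in> L\<^sup>*" using to_top[OF that(2)] sym by (meson sym_rtrancl symD)
    with to_top[OF that(1)] show ?thesis by (rule rtrancl_trans)
  qed
  moreover have "W \<noteq> {}" using v0 by (auto simp: W_def)
  ultimately have conn: "Digraph_Component.connected (with_proj (network M))"
    unfolding connected_pair_graph_iff[OF graph] by (simp add: M_def)
  have fS: "f s \<in> W" "f (\<tau> s) \<in> W" if "s \<in> S" for s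
    using that by (auto simp: f_def cW V_def)
  have "1 \<le> card S" using \<open>S \<noteq> {}\<close> finite_sources by (simp add: Suc_leI card_gt_0_iff)
  then have inst: "unicast_instance M"
    unfolding unicast_instance_def using graph conn sess fS
    by (auto simp: num) (auto simp: M_def)
  have \<tau>_neq: "s \<noteq> \<tau> s" if "s \<in> S" for s
    using distance[OF that, of 0] b by auto
  interpret unit_instance M "card S"
    by unfold_locales (use inst num sess \<tau>_neq in \<open>auto simp: f_def\<close>, simp add: M_def)
  have "A \<subseteq> links M" by (auto simp: links L_def usym_def)
  moreover have "inj_on (src M) {..<card S}"
    using xs(2) distinct_card[OF xs(2)] xs(1)
    by (intro inj_onI) (auto simp: sess f_def nth_eq_iff_index_eq)
  moreover have "src M ` {..<card S} = f ` S"
  proof -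
    have "src M ` {..<card S} = (\<lambda>i. f (xs ! i)) ` {..<card S}" by (intro image_cong) (auto simp: sess)
    also have "\<dots> = f ` S" 
      unfolding xs(1)[symmetric] distinct_card[OF xs(2)] by (force simp: set_conv_nth)
    finally show ?thesis .
  qed
  moreover have "gadget A {} (f ` S) (\<lambda>p. f (\<tau> (fst (h p)))) a 0"
    unfolding A_def by (rule gadget_image[of "\<lambda>p. fst (h p)"]) (simp add: f_def)
  ultimately have coding: "\<exists>P. coding_protocol M P \<and> has_completion_times M P (\<lambda>_. a)"
    by (intro ex_coding_protocol[of A "{}" "\<lambda>p. f (\<tau> (fst (h p)))" a 0]) (auto simp: sess f_def)

  \<comment> \<open>Both directions of every cut arc are counted, whence the factor 2 in the
    hypothesis on \<open>card F\<close>.\<close>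
  define C where "C = usym (map_prod f f ` F)"
  have finF: "finite F" using finite_arcs cut_subset finite_subset by blast
  have "C \<subseteq> links M" using cut_subset unfolding links C_def L_def A_def usym_def by auto
  have "finite C" using finF by (simp add: C_def usym_def)
  have "card C \<le> card (map_prod f f ` F) + card (map_prod f f ` F)"
    unfolding C_def usym_def by (metis card_Un_le card_inverse)
  also have "\<dots> \<le> 2 * card F" unfolding mult_2 by (intro add_mono card_image_le finF)
  finally have "b * card C \<le> b * (2 * card F)" by (rule mult_le_mono2)
  also have "\<dots> < card S" using F by (simp add: mult_ac)
  finally have "b * card C < card S" .
  have "\<forall>s\<in>S. \<exists>\<phi>. \<phi> s = 0 \<and> b \<le> \<phi> (\<tau> s) \<and> (\<forall>(u, v)\<in>usym (E - F). \<phi> v \<le> \<phi> u + (1::nat))"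
    using ex_distance_potential distance by metis
  then obtain \<phi> where \<phi>: "\<And>s. s \<in> S \<Longrightarrow> \<phi> s s = 0" "\<And>s. s \<in> S \<Longrightarrow> b \<le> \<phi> s (\<tau> s)"
    "\<And>s u v. s \<in> S \<Longrightarrow> (u, v) \<in> usym (E - F) \<Longrightarrow> \<phi> s v \<le> \<phi> s u + (1::nat)"
    by (metis (no_types, lifting) case_prodD)
  \<comment> \<open>Distance in the gadget plus height, truncated at \<open>b\<close>. All tips have
    value \<open>b\<close>, so the links between tips never raise it.\<close>
  define \<psi> where "\<psi> i p = min b (\<phi> (xs ! i) (fst (h p)) + snd (h p))" for i p
  have \<psi>_step: "\<psi> i q \<le> \<psi> i p + 1" if i: "i < card S" and pq: "(p, q) \<in> L - C" for i p q
  proof -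
    have "(p, q) \<in> L" using pq by simp
    then show ?thesis
    proof (rule L_cases)
      fix u v assume *: "p = c u 0" "q = c v 0" "(u, v) \<in> usym E"
      have "(c x 0, c y 0) \<in> map_prod f f ` F" if "(x, y) \<in> F" for x y
        using that by (force simp: f_def)
      then have "(u, v) \<in> usym (E - F)"
        using * pq by (auto simp: C_def usym_iff)
      then show ?thesis using \<phi>(3)[OF sess(4)[OF i]] by (fastforce simp: \<psi>_def *)
    qed (auto simp: \<psi>_def)
  qed
  have "b \<le> makespan M T" if "routing_protocol M P" "has_completion_times M P T" for P T
    using that \<open>C \<subseteq> links M\<close> \<open>finite C\<close> \<open>b * card C < card S\<close>
    by (rule routing_makespan_ge[where \<phi> = \<psi>])
       (use \<phi> sess \<psi>_step in \<open>auto simp: \<psi>_def f_def links\<close>)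
  then show ?thesis
    using makespan_coding_gap_ge[OF coding] inst num by blast
qed

theorem theorem1p3:
  shows "\<exists>c :: real. c > 0 \<and>
    (\<exists>\<M> :: nat \<Rightarrow> nat unicast.
       (\<forall>n. unicast_instance (\<M> n)) \<and>
       filterlim (\<lambda>n. num_sessions (\<M> n)) at_top sequentially \<and>
       (\<lambda>n. makespan_coding_gap (\<M> n)) \<in> \<Omega>(\<lambda>n. ln (real (num_sessions (\<M> n))) powr c))"
proof -
  \<comment> \<open>\<open>Q\<close> is \<open>40000 * 2 * 5\<close>, so that \<open>Q ^ x\<close>
    bounds \<open>40000 ^ x * N\<close>, which in turn bounds the logarithm of the number of
    sessions; \<open>c\<close> is chosen to make \<open>Q powr c\<close> equal to
    \<open>5 / 4\<close>.\<close>
  define Q :: real where "Q = 400000"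
  define c where "c = ln (5 / 4) / ln Q"
  have c: "0 < c" by (simp add: c_def Q_def)
  have Qc: "Q powr c = 5 / 4" by (simp add: c_def powr_def Q_def)
  have "\<exists>M :: nat unicast. unicast_instance M \<and> n \<le> num_sessions M \<and>
      ln (real (num_sessions M)) powr c \<le> makespan_coding_gap M" for n
  proof -
    define x :: nat where "x = 2 ^ n"
    \<comment> \<open>This exceeds \<open>2 * (5 ^ x - 1)\<close>, twice the distance bound, so that
      the sources outnumber the cut sufficiently for \<open>ex_unicast_instance\<close>.\<close>
    define N :: nat where "N = 2 * 5 ^ x"
    have x: "1 \<le> x" by (simp add: x_def)
    have "(1::nat) \<le> 5 ^ x" by simp
    then have N: "2 \<le> N" unfolding N_def by linarith
    obtain E F :: "(vtx \<times> vtx) set" and S \<tau>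
      where G: "gadget E F S \<tau> (4 ^ x - 1) (5 ^ x - 1)" and S: "N \<le> card S" "N * card F \<le> card S"
        "card S \<le> N ^ 40000 ^ x"
      using sized_gadget_iterate[OF N, of n] unfolding sized_gadget_def x_def by blast
    have pow: "5 ^ 1 \<le> (5::nat) ^ x" "4 ^ 1 \<le> (4::nat) ^ x"
      using x by (intro power_increasing; simp)+
    have "2 * (5 ^ x - 1) * card F < card S"
    proof (cases "card F = 0")
      case True
      then show ?thesis using S(1) N by simp
    next
      case False
      have "2 * (5 ^ x - 1) < N" using pow unfolding N_def by simp
      then have "2 * (5 ^ x - 1) * card F < N * card F" using False by simp
      then show ?thesis using S(2) by (rule less_le_trans)
    qed
    moreover have "1 \<le> 5 ^ x - (1::nat)" using pow(1) by simp
    ultimately obtain M :: "nat unicast" where M: "unicast_instance M" "num_sessions M = card S"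
      "real (5 ^ x - 1) / real (4 ^ x - 1) \<le> makespan_coding_gap M"
      using ex_unicast_instance[OF G] by blast
    have "n < x" by (simp add: x_def)
    also have "x < 5 ^ x" by (rule power_gt_expt) simp
    finally have "n \<le> num_sessions M" using S(1) unfolding N_def M(2) by linarith

    have "0 < card S" using S(1) N by simp
    have "real (card S) \<le> real N ^ 40000 ^ x" using S(3) by (metis of_nat_le_iff of_nat_power)
    then have "ln (real (card S)) \<le> ln (real N ^ 40000 ^ x)"
      using \<open>0 < card S\<close> N by (intro ln_mono) auto
    also have "\<dots> = 40000 ^ x * ln (real N)"
      using N by (simp add: ln_realpow)
    also have "\<dots> \<le> 40000 ^ x * real N"
      using ln_bound[of "real N"] N by (intro mult_left_mono) auto
    also have "real N \<le> 2 ^ x * 5 ^ x"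
      using power_increasing[OF x, of "2::real"] by (simp add: N_def)
    also have "40000 ^ x * (2 ^ x * 5 ^ x) = Q ^ x"
      unfolding power_mult_distrib[symmetric] by (simp add: Q_def)
    finally have "ln (real (card S)) \<le> Q ^ x" by simp
    then have "ln (real (card S)) powr c \<le> (Q ^ x) powr c"
      using c \<open>0 < card S\<close> by (intro powr_mono2) auto
    also have "\<dots> = (Q powr c) ^ x"
      by (simp add: Q_def powr_realpow[symmetric] powr_powr mult.commute)
    also have "\<dots> = 5 ^ x / 4 ^ x" by (simp add: Qc power_divide)
    \<comment> \<open>Subtracting 1 from numerator and denominator does not decrease a fraction that
      is at least 1.\<close>
    also have "\<dots> \<le> real (5 ^ x - 1) / real (4 ^ x - 1)"
    proof -
      have "(4::real) ^ x \<le> 5 ^ x" by (intro power_mono) auto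
      moreover have "4 ^ 1 \<le> (4::real) ^ x" using x by (intro power_increasing) auto
      ultimately show ?thesis
        using pow by (simp add: of_nat_diff field_simps)
    qed
    also note M(3)
    finally show ?thesis using M \<open>n \<le> num_sessions M\<close> by auto
  qed
  then obtain \<M> :: "nat \<Rightarrow> nat unicast" where \<M>: "\<And>n. unicast_instance (\<M> n)"
    "\<And>n. n \<le> num_sessions (\<M> n)"
    "\<And>n. ln (real (num_sessions (\<M> n))) powr c \<le> makespan_coding_gap (\<M> n)"
    by metis
  have "filterlim (\<lambda>n. num_sessions (\<M> n)) at_top sequentially"
    by (rule filterlim_at_top_mono[OF filterlim_ident]) (use \<M>(2) in auto)
  moreover have "(\<lambda>n. makespan_coding_gap (\<M> n)) \<in> \<Omega>(\<lambda>n. ln (real (num_sessions (\<M> n))) powr c)"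
  proof (rule landau_omega.bigI[of 1])
    show "\<forall>\<^sub>F n in sequentially. 1 * norm (ln (real (num_sessions (\<M> n))) powr c)
        \<le> norm (makespan_coding_gap (\<M> n))"
      using \<M>(3) by (intro always_eventually) (force intro: order_trans[OF _ abs_ge_self])
  qed simp
  ultimately show ?thesis using c \<M>(1) by blast
qed

end
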